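(* Let $d=2$. Fix $\kappa\ge4$ an even integer, and fix an even integer $j$ with $2\le j\le\lfloor\kappa/2\rfloor$. There is a sequence $\{\mathcal{E}_n\}_{n=1}^\infty$, which depends on $\kappa$, such that $\{\mathcal{E}_n\}\subset\big(\cos^2(j\pi/\kappa),\ \cos((j-1)\pi/\kappa)\cos(j\pi/\kappa)\big)\cap\boldsymbol{\Theta}_\kappa(D)$ and $\mathcal{E}_{n+2}<\mathcal{E}_{n+1}<\mathcal{E}_n$ for all $n\ge1$. Also $\mathcal{E}_{2n-1},\mathcal{E}_{2n}\in\boldsymbol{\Theta}_{n,\kappa}(D)$ for all $n\ge1$, and for each $n\ge1$ there are real numbers $X_0,\ldots,X_{n+1}$ solving, with $\mathcal{E}_n$, the system $(\Sigma_n)$ of the context and satisfying $$\mathcal{E}_n/\cos((j-1)\pi/\kappa)=X_0<X_1<\cdots<X_n<X_{n+1}:=\cos((j-1)\pi/\kappa).$$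
   Context: Operators. For $d \geq 1$ let $\mathscr{H}=\ell^2(\mathbb{Z}^d)$, let $S_i$ be the shift $(S_i^{\pm 1} u)(n) = u(n_1,\ldots,n_i \mp 1,\ldots,n_d)$, $\Delta_i = \frac12 (S_i + S_i^* )$ and $D=D[d] = \prod_{i=1}^d \Delta_i$ (Molchanov--Vainberg Laplacian); $\sigma(D)=[-1,1]$. Let $(N_i u)(n) = n_i u(n)$. For $p,\kappa \in \mathbb{N}^*=\{1,2,\ldots\}$ let $A_i(p,\kappa)$ be the closure of $\frac{1}{4\mathrm{i}}\left[(S_i^{p\kappa}-S_i^{-p\kappa})N_i + N_i (S_i^{p\kappa}-S_i^{-p\kappa})\right]$ defined on compactly supported sequences, and $A_{p\kappa} = \sum_{i=1}^d A_i(p,\kappa)$ (self-adjoint). Thresholds. $\boldsymbol{\mu}_\kappa(D)$ is the set of $E \in \sigma(D)$ for which there exist a self-adjoint linear combination (finite or infinite) $\mathbb{A} = \sum_{p \geq 1} \rho_{p\kappa} A_{p\kappa}$, $\rho_{p\kappa}\in\mathbb{R}$, an interval $I \ni E$ and $\gamma>0$ with $1_I(D)[D,\mathrm{i}\mathbb{A}]_\circ 1_I(D) \geq \gamma 1_I(D)$, where $1_I(D)$ is the spectral projection of $D$ on $I$ and $[D,\mathrm{i}\mathbb{A}]_\circ$ is the bounded extension of the commutator from compactly supported sequences. $\boldsymbol{\Theta}_\kappa(D) = \sigma(D)\setminus \boldsymbol{\mu}_\kappa(D)$. Let $T_n,U_n$ be the Chebyshev polynomials of the first and second kind, $T_n(\cos\theta)=\cos(n\theta)$,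 $U_{n-1}(\cos\theta)=\sin(n\theta)/\sin\theta$. For $\vec{x}\in[-1,1]^d$ let $g_{p\kappa}(\vec{x}) = \sum_{i=1}^d \big(\prod_{l \neq i} x_l\big)(1-x_i^2)U_{p\kappa-1}(x_i)$, and $S_E = \{\vec{x}\in[-1,1]^d : \prod_{l=1}^d x_l = E\}$. The function $G_\kappa = \sum_p \rho_{p\kappa} g_{p\kappa}$ represents $[D,\mathrm{i}\mathbb{A}]_\circ$ by functional calculus (with $\Delta_i \leftrightarrow x_i$), and by continuity of $G_\kappa$, $E\in\boldsymbol{\mu}_\kappa(D)$ iff $G_\kappa>0$ on $S_E$ for some such $\mathbb{A}$. For $m\in\mathbb{N}^*$, $\boldsymbol{\Theta}_{m,\kappa}(D)$ is the set of $E\in[-1,1]$ such that there are $\vec{x}_0,\ldots,\vec{x}_m \in S_E$ and real numbers $\omega_0,\ldots,\omega_{m-1}\leq 0$ with $g_{p\kappa}(\vec{x}_m) = \sum_{q=0}^{m-1}\omega_q\, g_{p\kappa}(\vec{x}_q)$ for all $p\in\mathbb{N}^*$. System $(\Sigma_n)$ in the unknowns $\mathcal{E}_n,X_0,\ldots,X_{n+1}$: if $n$ is odd, $T_\kappa(X_q)=T_\kappa(X_{n-q})$ for $0\le q\le(n-1)/2$ and $X_{n-q}=\mathcal{E}_n/X_{1+q}$ for $-1\le q\le(n-1)/2$; if $n$ is even, $T_\kappa(X_q)=T_\kappa(X_{n-q})$ for $0\le q\le n/2-1$ and $X_{n-q}=\mathcal{E}_n/X_{1+q}$ for $-1\le q\le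 n/2-1$.
   Formalization: The case j = κ/2 (possible when 4 divides κ) is excluded, because then cos(jπ/κ) = 0, the interval (cos²(jπ/κ), cos((j−1)π/κ)cos(jπ/κ)) is (0,0), hence empty, and no such sequence can exist. *)

theory Defs
  imports "HOL-Analysis.Analysis" "HOL-Computational_Algebra.Polynomial"
begin

section \<open>The Hilbert space of square-summable sequences on the lattice\<close>

type_synonym 'd lattice_fun = "int ^ 'd \<Rightarrow> complex"

definition l2 :: "'d::finite lattice_fun set" where
  "l2 = {u. (\<lambda>n. (cmod (u n))\<^sup>2) summable_on UNIV}"

definition fin_supp :: "'d::finite lattice_fun set" where
  "fin_supp = {u. finite {n. u n \<noteq> 0}}"

text \<open>Conjugate-linear in the first argument.\<close>
definition l2_inner :: "'d::finite lattice_fun \<Rightarrow> 'd lattice_fun \<Rightarrow> complex" where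
  "l2_inner u v = (\<Sum>\<^sub>\<infinity>n. cnj (u n) * v n)"

definition l2_norm :: "'d::finite lattice_fun \<Rightarrow> real" where
  "l2_norm u = sqrt (\<Sum>\<^sub>\<infinity>n. (cmod (u n))\<^sup>2)"

section \<open>Operators\<close>

text \<open>
  A bounded operator is a total HOL function of which only the restriction to \<open>l2\<close> matters.
\<close>
type_synonym 'd operator = "'d lattice_fun \<Rightarrow> 'd lattice_fun"

definition bounded_op :: "'d::finite operator \<Rightarrow> bool" where
  "bounded_op T \<longleftrightarrow>
     (\<forall>u\<in>l2. T u \<in> l2) \<and>
     (\<forall>u\<in>l2. \<forall>v\<in>l2. T (\<lambda>n. u n + v n) = (\<lambda>n. T u n + T v n)) \<and>
     (\<forall>u\<in>l2. \<forall>c. T (\<lambda>n. c * u n) = (\<lambda>n. c * T u n)) \<and>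
     (\<exists>K. \<forall>u\<in>l2. l2_norm (T u) \<le> K * l2_norm u)"

definition spectrum :: "'d::finite operator \<Rightarrow> complex set" where
  "spectrum T = {z. \<not> (\<exists>R. bounded_op R \<and>
     (\<forall>u\<in>l2. R (\<lambda>n. T u n - z * u n) = u \<and> (\<lambda>n. T (R u) n - z * R u n) = u))}"

text \<open>The order on bounded self-adjoint operators, for which both sides below are real.\<close>
definition op_le :: "'d::finite operator \<Rightarrow> 'd operator \<Rightarrow> bool" where
  "op_le S T \<longleftrightarrow> (\<forall>u\<in>l2. Re (l2_inner u (S u)) \<le> Re (l2_inner u (T u)))"

definition orth_projection :: "'d::finite operator \<Rightarrow> bool" where
  "orth_projection P \<longleftrightarrow> bounded_op P \<and> (\<forall>u\<in>l2. P (P u) = P u) \<and>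
     (\<forall>u\<in>l2. \<forall>v\<in>l2. l2_inner (P u) v = l2_inner u (P v))"

text \<open>The scalar measure \<open>B \<mapsto> \<langle>u, P(B) u\<rangle>\<close> of a projection-valued measure \<open>P\<close>.\<close>
definition scalar_measure ::
    "(real set \<Rightarrow> 'd::finite operator) \<Rightarrow> 'd lattice_fun \<Rightarrow> real measure" where
  "scalar_measure P u = measure_of UNIV (sets borel) (\<lambda>B. ennreal (Re (l2_inner u (P B u))))"

text \<open>
  \<open>P\<close> is a projection-valued Borel measure with \<open>T = \<integral> t dP(t)\<close>. The square-integrability
  says that every vector lies in the domain of \<open>\<integral> t dP(t)\<close>, as it must since \<open>T\<close> is bounded.
  For \<open>T\<close> bounded and self-adjoint there is, by the spectral theorem, exactly one such \<open>P\<close>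
  (up to values outside \<open>l2\<close>), and the spectral projection of \<open>T\<close> on \<open>I\<close> is \<open>P I\<close>.
\<close>
definition spectral_resolution ::
    "'d::finite operator \<Rightarrow> (real set \<Rightarrow> 'd operator) \<Rightarrow> bool" where
  "spectral_resolution T P \<longleftrightarrow>
     (\<forall>B\<in>sets borel. orth_projection (P B)) \<and>
     (\<forall>u\<in>l2. P UNIV u = u) \<and>
     (\<forall>B::nat \<Rightarrow> real set. range B \<subseteq> sets borel \<longrightarrow> disjoint_family B \<longrightarrow>
        (\<forall>u\<in>l2. (\<lambda>k. l2_norm (\<lambda>n. P (\<Union>i. B i) u n - (\<Sum>i<k. P (B i) u n)))
                   \<longlonglongrightarrow> 0)) \<and>
     (\<forall>u\<in>l2. integrable (scalar_measure P u) (\<lambda>t. t\<^sup>2) \<and>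
        l2_inner u (T u) = complex_of_real (LINT t|scalar_measure P u. t))"

text \<open>An unbounded operator is given by its graph.\<close>
type_synonym 'd graph = "('d lattice_fun \<times> 'd lattice_fun) set"

definition closure_on_fin_supp :: "'d::finite operator \<Rightarrow> 'd graph" where
  "closure_on_fin_supp A = {(u, v). u \<in> l2 \<and> v \<in> l2 \<and>
     (\<exists>w :: nat \<Rightarrow> 'd lattice_fun. (\<forall>k. w k \<in> fin_supp) \<and>
        (\<lambda>k. l2_norm (\<lambda>n. w k n - u n)) \<longlonglongrightarrow> 0 \<and>
        (\<lambda>k. l2_norm (\<lambda>n. A (w k) n - v n)) \<longlonglongrightarrow> 0)}"

definition adjoint_graph :: "'d::finite graph \<Rightarrow> 'd graph" where
  "adjoint_graph G = {(w, z). w \<in> l2 \<and> z \<in> l2 \<and> (\<forall>(u, v)\<in>G. l2_inner w v = l2_inner z u)}"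

definition self_adjoint_graph :: "'d::finite graph \<Rightarrow> bool" where
  "self_adjoint_graph G \<longleftrightarrow>
     (\<forall>u\<in>l2. \<forall>e>0. \<exists>w\<in>Domain G. l2_norm (\<lambda>n. u n - w n) < e) \<and> adjoint_graph G = G"

section \<open>The Molchanov--Vainberg Laplacian and its conjugate operators\<close>

text \<open>\<open>shift i k\<close> is the \<open>k\<close>-th power of \<open>S\<^sub>i\<close>, for every integer \<open>k\<close>.\<close>
definition shift :: "'d::finite \<Rightarrow> int \<Rightarrow> 'd operator" where
  "shift i k u = (\<lambda>n. u (n - axis i k))"

definition Delta :: "'d::finite \<Rightarrow> 'd operator" where
  "Delta i u = (\<lambda>n. (shift i 1 u n + shift i (- 1) u n) / 2)"

text \<open>
  The composition of all \<open>Delta i\<close>; the order of the factors is irrelevant, see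
  \<open>comp_fun_commute_Delta\<close>.
\<close>
definition MV_laplacian :: "'d::finite operator" where
  "MV_laplacian = Finite_Set.fold (\<lambda>i T. Delta i \<circ> T) id UNIV"

definition position :: "'d::finite \<Rightarrow> 'd operator" where
  "position i u = (\<lambda>n. of_int (n $ i) * u n)"

text \<open>\<open>conj_op k\<close> is \<open>A\<^sub>k\<close> on finitely supported sequences.\<close>
definition conj_op_dir :: "'d::finite \<Rightarrow> nat \<Rightarrow> 'd operator" where
  "conj_op_dir i k u =
     (let W = (\<lambda>v n. shift i (int k) v n - shift i (- int k) v n)
      in (\<lambda>n. (1 / (4 * \<i>)) * (W (position i u) n + position i (W u) n)))"

definition conj_op :: "nat \<Rightarrow> 'd::finite operator" where
  "conj_op k u = (\<lambda>n. \<Sum>i\<in>UNIV. conj_op_dir i k u n)"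

text \<open>
  \<open>A\<close> is, on finitely supported sequences, the finite or infinite linear combination
  \<open>\<Sum>p\<ge>1. \<rho> (p * \<kappa>) A\<^bsub>p * \<kappa>\<^esub>\<close>, the series converging strongly there.
\<close>
definition is_lin_comb :: "nat \<Rightarrow> (nat \<Rightarrow> real) \<Rightarrow> 'd::finite operator \<Rightarrow> bool" where
  "is_lin_comb \<kappa> \<rho> A \<longleftrightarrow> (\<forall>u\<in>fin_supp. A u \<in> l2 \<and>
     (\<lambda>M. l2_norm (\<lambda>n. A u n - (\<Sum>p = 1..M. of_real (\<rho> (p * \<kappa>)) * conj_op (p * \<kappa>) u n)))
       \<longlonglongrightarrow> 0)"

text \<open>\<open>C\<close> is the bounded extension of the commutator \<open>[T, \<i>A]\<close> from finitely supported sequences.\<close>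
definition is_commutator_ext ::
    "'d::finite operator \<Rightarrow> 'd operator \<Rightarrow> 'd operator \<Rightarrow> bool" where
  "is_commutator_ext T A C \<longleftrightarrow> bounded_op C \<and>
     (\<forall>u\<in>fin_supp. C u = (\<lambda>n. T (\<lambda>m. \<i> * A u m) n - \<i> * A (T u) n))"

section \<open>Thresholds\<close>

text \<open>
  The first argument of the following sets only carries the dimension \<open>d = CARD('d)\<close>.

  The interval around \<open>E\<close> is open: for the degenerate interval \<open>{E}\<close> the spectral projection
  vanishes and the Mourre estimate would hold trivially.
\<close>
definition sigma_D :: "'d::finite itself \<Rightarrow> real set" where
  "sigma_D _ = {E. complex_of_real E \<in> spectrum (MV_laplacian :: 'd operator)}"

definition mu_set :: "'d::finite itself \<Rightarrow> nat \<Rightarrow> real set" where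
  "mu_set d \<kappa> = {E \<in> sigma_D d.
     \<exists>(\<rho> :: nat \<Rightarrow> real) (A :: 'd operator) C P a b \<gamma>.
       is_lin_comb \<kappa> \<rho> A \<and>
       self_adjoint_graph (closure_on_fin_supp A) \<and>
       is_commutator_ext MV_laplacian A C \<and>
       spectral_resolution MV_laplacian P \<and>
       a < E \<and> E < b \<and> \<gamma> > 0 \<and>
       op_le (\<lambda>u n. of_real \<gamma> * P {a<..<b} u n) (P {a<..<b} \<circ> C \<circ> P {a<..<b})}"

definition Theta_set :: "'d::finite itself \<Rightarrow> nat \<Rightarrow> real set" where
  "Theta_set d \<kappa> = sigma_D d - mu_set d \<kappa>"

fun cheb_T :: "nat \<Rightarrow> real poly" where
  "cheb_T 0 = 1"
| "cheb_T (Suc 0) = [:0, 1:]"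
| "cheb_T (Suc (Suc n)) = [:0, 2:] * cheb_T (Suc n) - cheb_T n"

fun cheb_U :: "nat \<Rightarrow> real poly" where
  "cheb_U 0 = 1"
| "cheb_U (Suc 0) = [:0, 2:]"
| "cheb_U (Suc (Suc n)) = [:0, 2:] * cheb_U (Suc n) - cheb_U n"

definition g_fun :: "nat \<Rightarrow> real ^ 'd::finite \<Rightarrow> real" where
  "g_fun k x = (\<Sum>i\<in>UNIV. (\<Prod>l\<in>UNIV - {i}. x $ l) * (1 - (x $ i)\<^sup>2) * poly (cheb_U (k - 1)) (x $ i))"

definition S_surface :: "real \<Rightarrow> (real ^ 'd::finite) set" where
  "S_surface E = {x. (\<forall>i. x $ i \<in> {-1..1}) \<and> (\<Prod>l\<in>UNIV. x $ l) = E}"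

definition Theta_m_set :: "'d::finite itself \<Rightarrow> nat \<Rightarrow> nat \<Rightarrow> real set" where
  "Theta_m_set _ m \<kappa> = {E \<in> {-1..1}.
     \<exists>(x :: nat \<Rightarrow> real ^ 'd) (\<omega> :: nat \<Rightarrow> real).
       (\<forall>q\<le>m. x q \<in> S_surface E) \<and> (\<forall>q<m. \<omega> q \<le> 0) \<and>
       (\<forall>p\<ge>1. g_fun (p * \<kappa>) (x m) = (\<Sum>q<m. \<omega> q * g_fun (p * \<kappa>) (x q)))}"

text \<open>
  The range of the index in the second family of equations starts at \<open>-1\<close>; that case is the
  separate equation for \<open>X (n + 1)\<close>.
\<close>
definition Sigma_system :: "nat \<Rightarrow> nat \<Rightarrow> real \<Rightarrow> (nat \<Rightarrow> real) \<Rightarrow> bool" where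
  "Sigma_system \<kappa> n E X \<longleftrightarrow>
     X (n + 1) = E / X 0 \<and>
     (if odd n
      then (\<forall>q\<le>(n - 1) div 2. poly (cheb_T \<kappa>) (X q) = poly (cheb_T \<kappa>) (X (n - q)) \<and>
                               X (n - q) = E / X (1 + q))
      else (\<forall>q<n div 2. poly (cheb_T \<kappa>) (X q) = poly (cheb_T \<kappa>) (X (n - q)) \<and>
                         X (n - q) = E / X (1 + q)))"

section \<open>Checks of the definitions\<close>

lemma comp_fun_commute_Delta: "comp_fun_commute (\<lambda>i T. Delta (i :: 'd::finite) \<circ> T)"
  by standard (auto simp: Delta_def shift_def fun_eq_iff algebra_simps add_divide_distrib)

lemma MV_laplacian_2:
  "MV_laplacian u n =
     (u (n + axis 1 1 + axis 2 1) + u (n + axis 1 1 - axis 2 1) +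
      u (n - axis 1 1 + axis 2 1) + u (n - axis 1 1 - axis (2::2) 1)) / 4"
proof -
  interpret comp_fun_commute "\<lambda>i T. Delta (i :: 2) \<circ> T"
    by (rule comp_fun_commute_Delta)
  have neg: "n - axis i (- 1) = n + axis i 1" for n :: "int ^ 2" and i
    by (simp add: vec_eq_iff axis_def)
  have "MV_laplacian = Delta (1::2) \<circ> (Delta 2 \<circ> id)"
    unfolding MV_laplacian_def UNIV_2 by simp
  then have "MV_laplacian u n = Delta 1 (Delta 2 u) n"
    by (metis comp_apply id_apply)
  then show ?thesis
    by (simp add: Delta_def shift_def neg algebra_simps add_divide_distrib)
qed

lemma poly_cheb_T_cos: "poly (cheb_T n) (cos t) = cos (real n * t)"
proof (induction n rule: cheb_T.induct)
  case (3 n)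
  have "cos (real (Suc (Suc n)) * t) = 2 * cos t * cos (real (Suc n) * t) - cos (real n * t)"
    using cos_add[of "real (Suc n) * t" t] cos_diff[of "real (Suc n) * t" t]
    by (simp add: algebra_simps)
  then show ?case using 3 by simp
qed simp_all

lemma poly_cheb_U_cos: "poly (cheb_U n) (cos t) * sin t = sin (real (n + 1) * t)"
proof (induction n rule: cheb_U.induct)
  case 2
  show ?case using sin_double[of t] by simp
next
  case (3 n)
  have "sin (real (Suc (Suc n) + 1) * t) =
      2 * cos t * sin (real (Suc n + 1) * t) - sin (real (n + 1) * t)"
    using sin_add[of "real (Suc n + 1) * t" t] sin_diff[of "real (Suc n + 1) * t" t]
    by (simp add: algebra_simps)
  then show ?case using 3 by (simp add: algebra_simps)
qed simp_all

text \<open>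
  For \<open>2 * j = \<kappa>\<close> (possible when \<open>4\<close> divides \<open>\<kappa>\<close>) no sequence can lie in the interval.
\<close>
lemma interval_empty:
  assumes "2 * j = \<kappa>" "\<kappa> > 0"
  shows "{(cos (real j * pi / real \<kappa>))\<^sup>2 <..<
          cos ((real j - 1) * pi / real \<kappa>) * cos (real j * pi / real \<kappa>)} = {}"
proof -
  have "real j * pi / real \<kappa> = pi / 2"
    using assms by (auto simp: field_simps)
  then have "cos (real j * pi / real \<kappa>) = 0"
    by (metis cos_pi_half)
  then show ?thesis
    by (metis greaterThanLessThan_empty mult_zero_right order_refl power_zero_numeral)
qed

end

theory Submission
  imports Defs
begin

text \<open>
  Write \<open>\<phi>\<^sub>k (cos t) = sin t * sin (k t)\<close>; in dimension two the symbol is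
  \<open>g\<^sub>k (x, y) = y \<phi>\<^sub>k(x) + x \<phi>\<^sub>k(y)\<close>. The proof has an analytic and a geometric half.

  Analytic half: \<open>\<Theta>\<^sub>m\<close> consists of thresholds (\<open>Theta_m_subset_Theta\<close>). Plane waves
  \<open>exp (\<i> (s n\<^sub>1 + t n\<^sub>2))\<close> cut off to larger and larger boxes are normalised approximate
  eigenvectors of \<open>D\<close> for the value \<open>cos s cos t\<close> (\<open>packet_MV_eigen\<close>). So \<open>[-1, 1]\<close> lies in
  the spectrum, and a spectral projection of \<open>D\<close> on an open interval around that value
  asymptotically fixes them (\<open>spec_localisation\<close>). If the series defining the conjugate operator
  converges on the delta sequence at the origin, its coefficients are absolutely summable
  (\<open>lin_comb_coeffs_summable\<close>), so that the expectations of the commutator in the packets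
  converge to \<open>G = \<Sum>\<^sub>p \<rho> g\<close> at \<open>(cos s, cos t)\<close>. A Mourre estimate near \<open>E\<close> therefore
  makes \<open>G\<close> at least \<open>\<gamma> > 0\<close> at every point of \<open>S\<^sub>E\<close> (\<open>mourre_symbol_positive\<close>), whereas
  a relation \<open>g(x\<^sub>m) = \<Sum> \<omega>\<^sub>q g(x\<^sub>q)\<close> with all \<open>\<omega>\<^sub>q \<le> 0\<close>, summed over \<open>p\<close>,
  gives \<open>G(x\<^sub>m) \<le> 0\<close>.

  Geometric half: let \<open>a\<close>, \<open>b\<close>, \<open>c\<close> be the cosines of \<open>(j + 1)\<pi>/\<kappa>\<close>, \<open>j\<pi>/\<kappa>\<close>,
  \<open>(j - 1)\<pi>/\<kappa>\<close>, and let \<open>R\<close> be the map that \<open>t \<mapsto> 2j\<pi>/\<kappa> - t\<close> induces on \<open>x = cos t\<close>.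
  It fixes \<open>b\<close>, sends \<open>a\<close> to \<open>c\<close>, preserves \<open>T\<^sub>\<kappa>\<close>, and multiplies each \<open>\<phi>\<^bsub>p\<kappa>\<^esub>\<close> by a
  nonpositive factor on \<open>(a, b)\<close> that does not depend on \<open>p\<close>. The system \<open>\<Sigma>\<^sub>n\<close> follows from
  \<open>X\<^bsub>n+1-r\<^esub> = E / X\<^sub>r\<close> and \<open>X\<^bsub>n-q\<^esub> = R X\<^sub>q\<close>, which say that
  \<open>X\<^bsub>q+1\<^esub> = E / R(X\<^sub>q)\<close>: the chain is an orbit of \<open>x \<mapsto> E / R(x)\<close>, with
  \<open>X\<^sub>0 = E / c = E / R(a)\<close>. Only the condition in the middle restricts \<open>E\<close>:
  \<open>X\<^sub>m = \<surd>E\<close> for \<open>n = 2m - 1\<close>, while for \<open>n = 2m\<close> the middle entry is chosen to be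
  \<open>X\<^sub>m = b\<close>. Orbits increase strictly with \<open>E\<close> and stay below \<open>b\<close> at \<open>E = b\<^sup>2\<close>, so the
  intermediate value theorem yields such energies, and they interlace (\<open>reflected_chains_exist\<close>).

  The two halves meet in \<open>Theta_mI\<close>. Along a chain the signs alternate in such a way that each
  \<open>\<phi>(X\<^sub>r)\<close> is a nonnegative combination of \<open>g\<close> at the points \<open>(X\<^sub>q, X\<^bsub>n+1-q\<^esub>)\<close>,
  \<open>q \<le> r\<close> (\<open>alternating_chain_combination\<close>); in the middle \<open>g\<close> is a nonpositive multiple of
  \<open>\<phi>(X\<^bsub>m-1\<^esub>)\<close>.
\<close>

section \<open>Square-summable sequences\<close>

lemma l2_iff: "u \<in> l2 \<longleftrightarrow> (\<lambda>n. (cmod (u n))\<^sup>2) summable_on UNIV"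
  by (simp add: l2_def)

lemma l2_scale [intro, simp]:
  assumes "u \<in> l2" shows "(\<lambda>n. c * u n) \<in> l2"
  using summable_on_cmult_right[of "\<lambda>n. (cmod (u n))\<^sup>2" UNIV "(cmod c)\<^sup>2"] assms
  by (simp add: l2_iff norm_mult power_mult_distrib)

lemma l2_add [intro, simp]:
  assumes "u \<in> l2" "v \<in> l2" shows "(\<lambda>n. u n + v n) \<in> l2"
proof -
  have "(\<lambda>n. 2 * ((cmod (u n))\<^sup>2 + (cmod (v n))\<^sup>2)) summable_on UNIV"
    using assms by (intro summable_on_cmult_right summable_on_add) (auto simp: l2_iff)
  moreover have "(cmod (u n + v n))\<^sup>2 \<le> 2 * ((cmod (u n))\<^sup>2 + (cmod (v n))\<^sup>2)" for n
  proof -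
    have "(cmod (u n + v n))\<^sup>2 \<le> (cmod (u n) + cmod (v n))\<^sup>2"
      by (intro power_mono norm_triangle_ineq) auto
    also have "\<dots> \<le> 2 * ((cmod (u n))\<^sup>2 + (cmod (v n))\<^sup>2)"
      using zero_le_power2[of "cmod (u n) - cmod (v n)"] by (simp add: power2_eq_square algebra_simps)
    finally show ?thesis .
  qed
  ultimately show ?thesis
    unfolding l2_iff by (rule summable_on_comparison_test) auto
qed

lemma l2_uminus [intro, simp]: "u \<in> l2 \<Longrightarrow> (\<lambda>n. - u n) \<in> l2"
  using l2_scale[of u "-1"] by simp

lemma l2_diff [intro, simp]: "u \<in> l2 \<Longrightarrow> v \<in> l2 \<Longrightarrow> (\<lambda>n. u n - v n) \<in> l2"
  using l2_add[of u "\<lambda>n. - v n"] by simp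

lemma l2_zero [intro, simp]: "(\<lambda>n. 0) \<in> l2"
  by (simp add: l2_iff)

lemma l2_sum [intro, simp]:
  assumes "\<And>i. i \<in> I \<Longrightarrow> f i \<in> l2" shows "(\<lambda>n. \<Sum>i\<in>I. f i n) \<in> l2"
  using assms by (induction I rule: infinite_finite_induct) auto

lemma fin_supp_l2: "u \<in> fin_supp \<Longrightarrow> u \<in> l2"
  unfolding l2_iff fin_supp_def
  by (rule finite_nonzero_values_imp_summable_on) auto

lemma l2_inner_summable:
  assumes "u \<in> l2" "v \<in> l2" shows "(\<lambda>n. cnj (u n) * v n) summable_on UNIV"
proof -
  have "(\<lambda>n. (cmod (u n))\<^sup>2 + (cmod (v n))\<^sup>2) summable_on UNIV"
    using assms by (intro summable_on_add) (auto simp: l2_iff)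
  then have "(\<lambda>n. norm (cnj (u n) * v n)) summable_on UNIV"
  proof (rule summable_on_comparison_test)
    show "norm (cnj (u n) * v n) \<le> (cmod (u n))\<^sup>2 + (cmod (v n))\<^sup>2" for n
    proof -
      have "cmod (u n) * cmod (v n) \<le> 2 * cmod (u n) * cmod (v n)" by simp
      also have "\<dots> \<le> (cmod (u n))\<^sup>2 + (cmod (v n))\<^sup>2" by (rule sum_squares_bound)
      finally show ?thesis by (simp add: norm_mult)
    qed
  qed auto
  then show ?thesis by (rule abs_summable_summable)
qed

lemma l2_inner_add_right:
  assumes "u \<in> l2" "v \<in> l2" "w \<in> l2"
  shows "l2_inner u (\<lambda>n. v n + w n) = l2_inner u v + l2_inner u w"
  unfolding l2_inner_def using assms
  by (simp add: infsum_add[symmetric] l2_inner_summable ring_distribs)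

lemma l2_inner_scale_right: "l2_inner u (\<lambda>n. c * v n) = c * l2_inner u v"
proof -
  have "(\<lambda>n. cnj (u n) * (c * v n)) = (\<lambda>n. c * (cnj (u n) * v n))" by (simp add: fun_eq_iff)
  then show ?thesis unfolding l2_inner_def by (simp add: infsum_cmult_right')
qed

lemma l2_inner_commute: "l2_inner u v = cnj (l2_inner v u)"
  unfolding l2_inner_def infsum_cnj[symmetric] by (simp add: mult.commute)

lemma l2_inner_add_left:
  assumes "u \<in> l2" "v \<in> l2" "w \<in> l2"
  shows "l2_inner (\<lambda>n. v n + w n) u = l2_inner v u + l2_inner w u"
  using l2_inner_add_right[OF assms] by (metis l2_inner_commute complex_cnj_add)

lemma l2_inner_scale_left: "l2_inner (\<lambda>n. c * v n) u = cnj c * l2_inner v u"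
  by (metis l2_inner_commute complex_cnj_mult l2_inner_scale_right)

lemma l2_inner_diff_right:
  assumes "u \<in> l2" "v \<in> l2" "w \<in> l2"
  shows "l2_inner u (\<lambda>n. v n - w n) = l2_inner u v - l2_inner u w"
  using l2_inner_add_right[of u v "\<lambda>n. (-1) * w n"] l2_inner_scale_right[of u "-1" w] assms by simp

lemma l2_inner_diff_left:
  assumes "u \<in> l2" "v \<in> l2" "w \<in> l2"
  shows "l2_inner (\<lambda>n. v n - w n) u = l2_inner v u - l2_inner w u"
  using l2_inner_diff_right[OF assms] by (metis l2_inner_commute complex_cnj_diff)

lemma l2_inner_sum_right:
  assumes "u \<in> l2" "\<And>i. i \<in> I \<Longrightarrow> f i \<in> l2"
  shows "l2_inner u (\<lambda>n. \<Sum>i\<in>I. f i n) = (\<Sum>i\<in>I. l2_inner u (f i))"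
  using assms
proof (induction I rule: infinite_finite_induct)
  case (insert i I)
  then show ?case by (simp add: l2_inner_add_right)
qed (simp_all add: l2_inner_def)

lemma l2_norm_ge_0 [simp]: "l2_norm u \<ge> 0"
  by (simp add: l2_norm_def infsum_nonneg)

text \<open>
  Holds for every sequence: if \<open>u\<close> is not square-summable, both infinite sums take the value zero.
\<close>
lemma l2_inner_self: "l2_inner u u = of_real ((l2_norm u)\<^sup>2)"
proof -
  have "(\<lambda>n. cnj (u n) * u n) = (\<lambda>n. complex_of_real ((cmod (u n))\<^sup>2))"
    by (simp add: fun_eq_iff complex_norm_square mult.commute del: of_real_power)
  moreover have "(\<Sum>\<^sub>\<infinity>n. complex_of_real ((cmod (u n))\<^sup>2)) = of_real (\<Sum>\<^sub>\<infinity>n. (cmod (u n))\<^sup>2)"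
  proof (cases "(\<lambda>n. (cmod (u n))\<^sup>2) summable_on UNIV")
    case True
    from has_sum_of_real[OF has_sum_infsum[OF this]] show ?thesis by (rule infsumI)
  next
    case False
    then have "\<not> (\<lambda>n. complex_of_real ((cmod (u n))\<^sup>2)) summable_on UNIV"
      using summable_on_Re by (metis (no_types, lifting) Re_complex_of_real summable_on_cong)
    from infsum_not_exists[OF this] infsum_not_exists[OF False] show ?thesis by (simp del: of_real_power)
  qed
  ultimately show ?thesis
    by (simp add: l2_inner_def l2_norm_def infsum_nonneg)
qed

lemma l2_norm_add_sq:
  assumes "u \<in> l2" "v \<in> l2"
  shows "(l2_norm (\<lambda>n. u n + v n))\<^sup>2 = (l2_norm u)\<^sup>2 + 2 * Re (l2_inner u v) + (l2_norm v)\<^sup>2"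
proof -
  have "complex_of_real ((l2_norm (\<lambda>n. u n + v n))\<^sup>2) =
      l2_inner u u + l2_inner u v + (cnj (l2_inner u v) + l2_inner v v)"
    unfolding l2_inner_self[symmetric] using assms
    by (subst l2_inner_commute[of u v])
       (simp add: l2_inner_add_left l2_inner_add_right)
  then show ?thesis
    by (simp only: l2_inner_self complex_eq_iff) simp
qed

lemma l2_norm_scale: "l2_norm (\<lambda>n. c * u n) = cmod c * l2_norm u"
proof -
  have "complex_of_real ((l2_norm (\<lambda>n. c * u n))\<^sup>2) = (c * cnj c) * of_real ((l2_norm u)\<^sup>2)"
    unfolding l2_inner_self[symmetric] l2_inner_scale_left l2_inner_scale_right by simp
  also have "\<dots> = of_real ((cmod c * l2_norm u)\<^sup>2)"
    by (simp only: complex_norm_square[symmetric] power_mult_distrib of_real_mult of_real_power)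
  finally have "(l2_norm (\<lambda>n. c * u n))\<^sup>2 = (cmod c * l2_norm u)\<^sup>2"
    by (simp only: of_real_eq_iff)
  then show ?thesis by (rule power2_eq_imp_eq) simp_all
qed

text \<open>
  The squared norm of \<open>u - t \<langle>v, u\<rangle> v\<close> is a nonnegative quadratic polynomial in the real
  parameter \<open>t\<close>.
\<close>
lemma l2_cauchy_schwarz:
  assumes "u \<in> l2" "v \<in> l2"
  shows "cmod (l2_inner u v) \<le> l2_norm u * l2_norm v"
proof -
  define s where "s = l2_inner v u"
  define N where "N = (l2_norm v)\<^sup>2"
  have quad: "0 \<le> (l2_norm u)\<^sup>2 - 2 * t * (cmod s)\<^sup>2 + t\<^sup>2 * (cmod s)\<^sup>2 * N" for t :: real
  proof -
    have "0 \<le> (l2_norm (\<lambda>n. u n + (- of_real t * s) * v n))\<^sup>2" by simp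
    also have "\<dots> = (l2_norm u)\<^sup>2 + 2 * Re (l2_inner u (\<lambda>n. (- of_real t * s) * v n)) +
        (l2_norm (\<lambda>n. (- of_real t * s) * v n))\<^sup>2"
      using assms by (intro l2_norm_add_sq l2_scale)
    also have "l2_inner u (\<lambda>n. (- of_real t * s) * v n) = of_real (- t * (cmod s)\<^sup>2)"
      unfolding l2_inner_scale_right l2_inner_commute[of u v] s_def[symmetric]
      by (simp add: complex_norm_square del: of_real_power)
    also have "l2_norm (\<lambda>n. (- of_real t * s) * v n) = \<bar>t\<bar> * cmod s * l2_norm v"
      by (subst l2_norm_scale) (simp add: norm_mult)
    finally show ?thesis by (simp add: N_def power_mult_distrib algebra_simps)
  qed
  have "(cmod s)\<^sup>2 \<le> (l2_norm u)\<^sup>2 * N"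
  proof (cases "N = 0")
    case True
    have "cmod s = 0"
    proof (rule ccontr)
      assume "cmod s \<noteq> 0"
      then show False
        using quad[of "((l2_norm u)\<^sup>2 + 1) / (cmod s)\<^sup>2"] True
        by (simp add: field_simps) (smt (verit) mult_nonneg_nonneg zero_le_power2 zero_less_power2 norm_eq_zero)
    qed
    then show ?thesis using True by simp
  next
    case False
    then have "N > 0" by (simp add: N_def)
    then show ?thesis using quad[of "1 / N"]
      by (simp add: field_simps power2_eq_square)
  qed
  then have "(cmod s)\<^sup>2 \<le> (l2_norm u * l2_norm v)\<^sup>2"
    by (simp add: N_def power_mult_distrib)
  then have "cmod s \<le> l2_norm u * l2_norm v"
    by (rule power2_le_imp_le) simp
  then show ?thesis by (simp add: s_def l2_inner_commute[of u v])
qed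

lemma l2_norm_triangle:
  assumes "u \<in> l2" "v \<in> l2"
  shows "l2_norm (\<lambda>n. u n + v n) \<le> l2_norm u + l2_norm v"
proof (rule power2_le_imp_le)
  have "Re (l2_inner u v) \<le> l2_norm u * l2_norm v"
    using complex_Re_le_cmod l2_cauchy_schwarz[OF assms] by (rule order_trans)
  then show "(l2_norm (\<lambda>n. u n + v n))\<^sup>2 \<le> (l2_norm u + l2_norm v)\<^sup>2"
    by (simp add: l2_norm_add_sq[OF assms] power2_sum)
qed simp

lemma l2_norm_sum:
  assumes "\<And>i. i \<in> I \<Longrightarrow> f i \<in> l2"
  shows "l2_norm (\<lambda>n. \<Sum>i\<in>I. f i n) \<le> (\<Sum>i\<in>I. l2_norm (f i))"
  using assms
proof (induction I rule: infinite_finite_induct)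
  case (insert i I)
  then have "l2_norm (\<lambda>n. f i n + (\<Sum>i\<in>I. f i n)) \<le> l2_norm (f i) + l2_norm (\<lambda>n. \<Sum>i\<in>I. f i n)"
    by (intro l2_norm_triangle l2_sum) auto
  with insert show ?case by (simp add: order_trans)
qed (simp_all add: l2_norm_def)

lemma norm_le_l2_norm:
  assumes "u \<in> l2" shows "cmod (u n) \<le> l2_norm u"
proof -
  have "(\<Sum>m\<in>{n}. (cmod (u m))\<^sup>2) \<le> (\<Sum>\<^sub>\<infinity>n. (cmod (u n))\<^sup>2)"
    using assms by (intro finite_sum_le_infsum) (auto simp: l2_iff)
  then show ?thesis unfolding l2_norm_def by (intro real_le_rsqrt) simp
qed

lemma l2_norm_eq_0: "u \<in> l2 \<Longrightarrow> l2_norm u = 0 \<Longrightarrow> u = (\<lambda>n. 0)"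
  using norm_le_l2_norm[of u] by (force simp: fun_eq_iff)

lemma l2_inner_fin_supp:
  assumes "finite F" "\<And>n. n \<notin> F \<Longrightarrow> u n = 0"
  shows "l2_inner u v = (\<Sum>n\<in>F. cnj (u n) * v n)"
proof -
  have "l2_inner u v = (\<Sum>\<^sub>\<infinity>n\<in>F. cnj (u n) * v n)"
    unfolding l2_inner_def using assms by (intro infsum_cong_neutral) auto
  then show ?thesis using assms by simp
qed

lemma l2_translate:
  assumes "u \<in> l2" shows "(\<lambda>n. u (n + k)) \<in> l2"
proof -
  have "bij_betw (\<lambda>n. n + k) UNIV UNIV" by (rule bij_betw_byWitness[of _ "\<lambda>n. n - k"]) auto
  from summable_on_reindex_bij_betw[OF this, of "\<lambda>n. (cmod (u n))\<^sup>2"] show ?thesis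
    using assms by (simp add: l2_iff)
qed

lemma l2_norm_translate: "l2_norm (\<lambda>n. u (n + k)) = l2_norm u"
proof -
  have "bij_betw (\<lambda>n. n + k) UNIV UNIV" by (rule bij_betw_byWitness[of _ "\<lambda>n. n - k"]) auto
  from infsum_reindex_bij_betw[OF this, of "\<lambda>n. (cmod (u n))\<^sup>2"] show ?thesis
    by (simp add: l2_norm_def)
qed

section \<open>Spectral localisation of approximate eigenvectors\<close>

lemma orth_projection_inner:
  assumes "orth_projection P" "u \<in> l2"
  shows "l2_inner u (P u) = of_real ((l2_norm (P u))\<^sup>2)"
  using assms unfolding orth_projection_def bounded_op_def
  by (metis l2_inner_self)

lemma orth_projection_in_l2: "orth_projection P \<Longrightarrow> u \<in> l2 \<Longrightarrow> P u \<in> l2"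
  by (simp add: orth_projection_def bounded_op_def)

lemma bounded_op_l2: "bounded_op T \<Longrightarrow> u \<in> l2 \<Longrightarrow> T u \<in> l2"
  and bounded_op_add:
    "bounded_op T \<Longrightarrow> u \<in> l2 \<Longrightarrow> v \<in> l2 \<Longrightarrow> T (\<lambda>n. u n + v n) = (\<lambda>n. T u n + T v n)"
  and bounded_op_scale: "bounded_op T \<Longrightarrow> u \<in> l2 \<Longrightarrow> T (\<lambda>n. c * u n) = (\<lambda>n. c * T u n)"
  by (simp_all add: bounded_op_def)

lemma bounded_op_diff:
  assumes "bounded_op T" "u \<in> l2" "v \<in> l2"
  shows "T (\<lambda>n. u n - v n) = (\<lambda>n. T u n - T v n)"
  using bounded_op_add[OF assms(1,2) l2_scale[OF assms(3), of "-1"]]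
    bounded_op_scale[OF assms(1,3), of "-1"] by simp

text \<open>
  The spectral resolution is only known through its scalar measures and the first moments
  \<open>\<langle>u, T u\<rangle> = \<integral> t d\<mu>\<^sub>u\<close>. Relations between the projections of different sets are read
  off from the monotonicity of \<open>B \<mapsto> \<langle>u, P(B) u\<rangle> = \<parallel>P(B) u\<parallel>\<^sup>2\<close>.
\<close>
locale spectral_op =
  fixes T :: "'d::finite operator" and P :: "real set \<Rightarrow> 'd operator"
  assumes T: "bounded_op T" and P: "spectral_resolution T P"
begin

lemma spec_proj: "B \<in> sets borel \<Longrightarrow> orth_projection (P B)"
  and spec_UNIV: "u \<in> l2 \<Longrightarrow> P UNIV u = u"
  using P by (auto simp: spectral_resolution_def)

lemma spec_bounded: "B \<in> sets borel \<Longrightarrow> bounded_op (P B)"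
  using spec_proj by (simp add: orth_projection_def)

lemma spec_l2 [intro, simp]: "B \<in> sets borel \<Longrightarrow> u \<in> l2 \<Longrightarrow> P B u \<in> l2"
  using spec_proj orth_projection_in_l2 by blast

lemma spec_inner: "B \<in> sets borel \<Longrightarrow> u \<in> l2 \<Longrightarrow> l2_inner u (P B u) = of_real ((l2_norm (P B u))\<^sup>2)"
  using spec_proj orth_projection_inner by blast

lemma spec_symmetric:
  "B \<in> sets borel \<Longrightarrow> u \<in> l2 \<Longrightarrow> v \<in> l2 \<Longrightarrow> l2_inner (P B u) v = l2_inner u (P B v)"
  using spec_proj unfolding orth_projection_def by blast

lemma spec_idem: "B \<in> sets borel \<Longrightarrow> u \<in> l2 \<Longrightarrow> P B (P B u) = P B u"
  using spec_proj unfolding orth_projection_def by blast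

lemma spec_add: "B \<in> sets borel \<Longrightarrow> u \<in> l2 \<Longrightarrow> v \<in> l2 \<Longrightarrow> P B (\<lambda>n. u n + v n) = (\<lambda>n. P B u n + P B v n)"
  using spec_bounded by (simp add: bounded_op_def)

lemma spec_diff: "B \<in> sets borel \<Longrightarrow> u \<in> l2 \<Longrightarrow> v \<in> l2 \<Longrightarrow> P B (\<lambda>n. u n - v n) = (\<lambda>n. P B u n - P B v n)"
  by (rule bounded_op_diff[OF spec_bounded])

lemma spec_sigma_additive:
  assumes "range B \<subseteq> sets borel" "disjoint_family B" "u \<in> l2"
  shows "(\<lambda>k. l2_norm (\<lambda>n. P (\<Union>i. B i) u n - (\<Sum>i<k. P (B i) u n))) \<longlonglongrightarrow> 0"
  using P assms unfolding spectral_resolution_def by blast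

lemma spec_sums:
  fixes B :: "nat \<Rightarrow> real set"
  assumes B: "range B \<subseteq> sets borel" "disjoint_family B" and "u \<in> l2" "v \<in> l2"
  shows "(\<lambda>i. l2_inner v (P (B i) u)) sums l2_inner v (P (\<Union>i. B i) u)"
  unfolding sums_def
proof (rule Lim_transform2)
  have Bi: "B i \<in> sets borel" for i using B by auto
  have U: "(\<Union>i. B i) \<in> sets borel" using Bi by auto
  show "(\<lambda>k. l2_inner v (P (\<Union>i. B i) u)) \<longlonglongrightarrow> l2_inner v (P (\<Union>i. B i) u)" by simp
  have "(\<lambda>k. l2_norm v * l2_norm (\<lambda>n. P (\<Union>i. B i) u n - (\<Sum>i<k. P (B i) u n))) \<longlonglongrightarrow> l2_norm v * 0"
    using assms by (intro tendsto_mult tendsto_const spec_sigma_additive)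
  then have lim: "(\<lambda>k. l2_norm v * l2_norm (\<lambda>n. P (\<Union>i. B i) u n - (\<Sum>i<k. P (B i) u n))) \<longlonglongrightarrow> 0"
    by simp
  show "(\<lambda>k. l2_inner v (P (\<Union>i. B i) u) - (\<Sum>i<k. l2_inner v (P (B i) u))) \<longlonglongrightarrow> 0"
  proof (rule Lim_null_comparison[OF always_eventually lim], rule allI)
    fix k
    have "l2_inner v (P (\<Union>i. B i) u) - (\<Sum>i<k. l2_inner v (P (B i) u)) =
        l2_inner v (\<lambda>n. P (\<Union>i. B i) u n - (\<Sum>i<k. P (B i) u n))"
      using assms Bi U by (simp add: l2_inner_diff_right l2_inner_sum_right)
    also have "cmod \<dots> \<le> l2_norm v * l2_norm (\<lambda>n. P (\<Union>i. B i) u n - (\<Sum>i<k. P (B i) u n))"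
      using assms Bi U by (intro l2_cauchy_schwarz) auto
    finally show "cmod (l2_inner v (P (\<Union>i. B i) u) - (\<Sum>i<k. l2_inner v (P (B i) u)))
      \<le> l2_norm v * l2_norm (\<lambda>n. P (\<Union>i. B i) u n - (\<Sum>i<k. P (B i) u n))" .
  qed
qed

text \<open>
  The union of countably many copies of the empty set is empty, and a constant series converges
  only if its terms vanish.
\<close>
lemma spec_empty:
  assumes "u \<in> l2" "v \<in> l2" shows "l2_inner v (P {} u) = 0"
proof -
  have "(\<lambda>i::nat. l2_inner v (P {} u)) sums l2_inner v (P (\<Union>i::nat. {}) u)"
    using assms by (intro spec_sums) (auto simp: disjoint_family_on_def)
  then have "summable (\<lambda>i::nat. l2_inner v (P {} u))" by (rule sums_summable)
  then show ?thesis by (simp add: summable_const_iff)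
qed

lemma spec_Un:
  assumes "A \<in> sets borel" "B \<in> sets borel" "A \<inter> B = {}" "u \<in> l2" "v \<in> l2"
  shows "l2_inner v (P (A \<union> B) u) = l2_inner v (P A u) + l2_inner v (P B u)"
proof -
  have "(\<lambda>i. l2_inner v (P (binaryset A B i) u)) sums l2_inner v (P (\<Union>i. binaryset A B i) u)"
    using assms by (intro spec_sums) (auto simp: binaryset_def disjoint_family_on_def)
  moreover have "(\<lambda>i. l2_inner v (P (binaryset A B i) u)) sums (l2_inner v (P A u) + l2_inner v (P B u))"
    by (rule binaryset_sums) (use assms spec_empty in auto)
  ultimately show ?thesis by (simp add: UN_binaryset_eq sums_iff)
qed

text \<open>
  \<open>\<langle>u, P(B) u\<rangle>\<close> is the sum of the two squares \<open>\<parallel>P(A) u\<parallel>\<^sup>2\<close> and \<open>\<parallel>P(B - A) u\<parallel>\<^sup>2\<close>.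
\<close>
lemma spec_mono_zero:
  assumes "A \<in> sets borel" "B \<in> sets borel" "A \<subseteq> B" "u \<in> l2" "P B u = (\<lambda>n. 0)"
  shows "P A u = (\<lambda>n. 0)"
proof -
  have "l2_inner u (P (A \<union> (B - A)) u) = l2_inner u (P A u) + l2_inner u (P (B - A) u)"
    using assms by (intro spec_Un) auto
  moreover have "A \<union> (B - A) = B" using assms by blast
  ultimately have "complex_of_real ((l2_norm (P B u))\<^sup>2) = of_real ((l2_norm (P A u))\<^sup>2 + (l2_norm (P (B - A) u))\<^sup>2)"
    using assms by (simp add: spec_inner)
  then have "(l2_norm (P B u))\<^sup>2 = (l2_norm (P A u))\<^sup>2 + (l2_norm (P (B - A) u))\<^sup>2"
    by (simp only: of_real_eq_iff)
  then have "(l2_norm (P A u))\<^sup>2 = 0"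
    using assms by (simp add: l2_norm_def add_nonneg_eq_0_iff)
  then show ?thesis using assms by (intro l2_norm_eq_0) auto
qed

text \<open>
  A vector \<open>w\<close> in the range of \<open>P(B)\<close> has \<open>\<langle>w, P(-B) w\<rangle> = \<parallel>w\<parallel>\<^sup>2 - \<parallel>w\<parallel>\<^sup>2\<close>, and
  \<open>A\<close> is contained in the complement of \<open>B\<close>.
\<close>
lemma spec_compl_zero:
  assumes "A \<in> sets borel" "B \<in> sets borel" "A \<inter> B = {}" "u \<in> l2"
  shows "P A (P B u) = (\<lambda>n. 0)"
proof -
  define w where "w = P B u"
  have w: "w \<in> l2" "P B w = w" using assms by (auto simp: w_def spec_idem)
  have "l2_inner w (P (B \<union> - B) w) = l2_inner w (P B w) + l2_inner w (P (- B) w)"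
    using assms w by (intro spec_Un) auto
  then have "l2_inner w (P (- B) w) = 0" using w by (simp add: spec_UNIV)
  then have "l2_norm (P (- B) w) = 0" using assms w by (simp add: spec_inner)
  then have "P (- B) w = (\<lambda>n. 0)" using assms w by (intro l2_norm_eq_0) auto
  then show ?thesis unfolding w_def[symmetric]
    using assms w by (intro spec_mono_zero[of A "- B"]) auto
qed

lemma scalar_measure_sets [simp, measurable_cong]: "sets (scalar_measure P u) = sets borel"
  and scalar_measure_space [simp]: "space (scalar_measure P u) = UNIV"
  by (auto simp: scalar_measure_def sets_measure_of_conv space_measure_of_conv
      sigma_algebra.sigma_sets_eq[OF sets.sigma_algebra_axioms[of borel, simplified]])

lemma emeasure_scalar_measure:
  assumes "u \<in> l2" "B \<in> sets borel"
  shows "emeasure (scalar_measure P u) B = ennreal ((l2_norm (P B u))\<^sup>2)"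
proof -
  have eq: "Re (l2_inner u (P B u)) = (l2_norm (P B u))\<^sup>2" if "B \<in> sets borel" for B
    using assms that by (simp add: spec_inner)
  have "emeasure (scalar_measure P u) B = ennreal (Re (l2_inner u (P B u)))"
  proof (rule emeasure_measure_of[OF scalar_measure_def])
    show "positive (sets (scalar_measure P u)) (\<lambda>B. ennreal (Re (l2_inner u (P B u))))"
      using assms by (simp add: positive_def spec_empty)
    show "countably_additive (sets (scalar_measure P u)) (\<lambda>B. ennreal (Re (l2_inner u (P B u))))"
    proof (rule countably_additiveI)
      fix A :: "nat \<Rightarrow> real set"
      assume A: "range A \<subseteq> sets (scalar_measure P u)" "disjoint_family A"
      then have Ai: "A i \<in> sets borel" for i by auto
      have "(\<lambda>i. Re (l2_inner u (P (A i) u))) sums Re (l2_inner u (P (\<Union>i. A i) u))"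
        using A assms by (intro sums_Re spec_sums) auto
      then show "(\<Sum>i. ennreal (Re (l2_inner u (P (A i) u)))) = ennreal (Re (l2_inner u (P (\<Union>i. A i) u)))"
        using Ai by (intro suminf_ennreal_eq) (simp_all add: eq)
    qed
  qed (use assms in auto)
  then show ?thesis using assms by (simp add: eq)
qed

lemma finite_scalar_measure: "u \<in> l2 \<Longrightarrow> finite_measure (scalar_measure P u)"
  by (rule finite_measureI) (simp add: emeasure_scalar_measure)

lemma measure_scalar_measure:
  "u \<in> l2 \<Longrightarrow> B \<in> sets borel \<Longrightarrow> measure (scalar_measure P u) B = (l2_norm (P B u))\<^sup>2"
  by (simp add: measure_def emeasure_scalar_measure)

lemma scalar_measure_integrable:
  assumes "u \<in> l2" shows "integrable (scalar_measure P u) (\<lambda>t. t)"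
proof -
  interpret finite_measure "scalar_measure P u" using assms by (rule finite_scalar_measure)
  have "integrable (scalar_measure P u) (\<lambda>t. t\<^sup>2)"
    using P assms unfolding spectral_resolution_def by blast
  then show ?thesis by (rule square_integrable_imp_integrable[rotated]) simp
qed

lemma spec_first_moment:
  "u \<in> l2 \<Longrightarrow> l2_inner u (T u) = of_real (LINT t|scalar_measure P u. t)"
  using P unfolding spectral_resolution_def by blast

text \<open>
  The scalar measures of vectors in the range and in the kernel of the same \<open>P(B)\<close> add up, because
  \<open>P(A) v\<close> and \<open>P(A) w\<close> are orthogonal for every Borel set \<open>A\<close>; so do their first moments.
\<close>
lemma scalar_measure_orth:
  assumes B: "B \<in> sets borel" and v: "v \<in> l2" "P B v = v" and w: "w \<in> l2" "P B w = (\<lambda>n. 0)"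
  shows "l2_inner (\<lambda>n. v n + w n) (T (\<lambda>n. v n + w n)) = l2_inner v (T v) + l2_inner w (T w)"
proof -
  let ?M = "scalar_measure P"
  have T1: "integrable (?M x) (\<lambda>t. t)" if "x \<in> l2" for x using that by (rule scalar_measure_integrable)
  have orth: "l2_inner v (P A w) = 0" if A: "A \<in> sets borel" for A
  proof -
    have "l2_inner v (P ((A \<inter> B) \<union> (A - B)) w) = l2_inner v (P (A \<inter> B) w) + l2_inner v (P (A - B) w)"
      using A B v w by (intro spec_Un) auto
    moreover have "P (A \<inter> B) w = (\<lambda>n. 0)"
      using spec_mono_zero[of "A \<inter> B" B w] A B w by auto
    moreover have "P (A - B) v = (\<lambda>n. 0)"
      using spec_compl_zero[of "A - B" B v] A B v by auto
    then have "l2_inner v (P (A - B) w) = 0"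
      using spec_symmetric[of "A - B" v w] A B v w by (simp add: l2_inner_def)
    ultimately show ?thesis by (simp add: Int_Diff_Un l2_inner_def)
  qed
  have sq: "(l2_norm (P A (\<lambda>n. v n + w n)))\<^sup>2 = (l2_norm (P A v))\<^sup>2 + (l2_norm (P A w))\<^sup>2"
    if A: "A \<in> sets borel" for A
  proof -
    have "l2_inner (P A v) (P A w) = 0"
      using orth[OF A] A v w by (simp add: spec_symmetric spec_idem)
    then show ?thesis using A v w by (simp add: spec_add l2_norm_add_sq)
  qed
  have sum_meas: "emeasure (?M (\<lambda>n. v n + w n)) A = emeasure (?M v) A + emeasure (?M w) A"
    if "A \<in> sets borel" for A
    using that v w by (simp add: emeasure_scalar_measure sq)
  have int: "(\<integral>\<^sup>+t. f t \<partial>?M (\<lambda>n. v n + w n)) = (\<integral>\<^sup>+t. f t \<partial>?M v) + (\<integral>\<^sup>+t. f t \<partial>?M w)"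
    if "f \<in> borel_measurable borel" for f :: "real \<Rightarrow> ennreal"
    using that
  proof (induction rule: borel_measurable_induct)
    case (cong f g) then show ?case by simp
  next
    case (set A)
    then show ?case by (simp add: sum_meas)
  next
    case (mult u c)
    then show ?case by (simp add: nn_integral_cmult distrib_left)
  next
    case (add u v)
    then show ?case by (simp add: nn_integral_add ac_simps)
  next
    case (seq U)
    have lim: "(\<lambda>i. \<integral>\<^sup>+t. U i t \<partial>?M x) \<longlonglongrightarrow> (\<integral>\<^sup>+t. Sup (range U) t \<partial>?M x)" for x
    proof -
      have "(\<integral>\<^sup>+t. Sup (range U) t \<partial>?M x) = (\<integral>\<^sup>+t. (SUP i. U i t) \<partial>?M x)"
        by (simp add: image_comp)
      also have "\<dots> = (SUP i. \<integral>\<^sup>+t. U i t \<partial>?M x)"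
        using seq by (intro nn_integral_monotone_convergence_SUP) auto
      moreover have "incseq (\<lambda>i. \<integral>\<^sup>+t. U i t \<partial>?M x)"
        using \<open>incseq U\<close> by (auto simp: incseq_def le_fun_def intro!: nn_integral_mono)
      ultimately show ?thesis using LIMSEQ_SUP by metis
    qed
    have "(\<lambda>i. \<integral>\<^sup>+t. U i t \<partial>?M (\<lambda>n. v n + w n)) \<longlonglongrightarrow>
        (\<integral>\<^sup>+t. Sup (range U) t \<partial>?M v) + (\<integral>\<^sup>+t. Sup (range U) t \<partial>?M w)"
      using tendsto_add[OF lim[of v] lim[of w]] seq by simp
    from LIMSEQ_unique[OF lim this] show ?case using \<open>f = _\<close> by simp
  qed
  \<comment> \<open>Positive and negative parts are finite, so additivity passes from \<open>int\<close> to signed integrals.\<close>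
  have "(LINT t|?M (\<lambda>n. v n + w n). t) = (LINT t|?M v. t) + (LINT t|?M w. t)"
  proof -
    have fin: "(\<integral>\<^sup>+t. ennreal (s * t) \<partial>?M x) < \<infinity>" if "x \<in> l2" "\<bar>s\<bar> = 1" for x and s :: real
    proof -
      have "integrable (?M x) (\<lambda>t. s * t)" using T1[OF that(1)] by simp
      then show ?thesis unfolding real_integrable_def by (auto simp: less_top)
    qed
    have pl: "enn2real (\<integral>\<^sup>+t. ennreal (s * t) \<partial>?M (\<lambda>n. v n + w n)) =
        enn2real (\<integral>\<^sup>+t. ennreal (s * t) \<partial>?M v) + enn2real (\<integral>\<^sup>+t. ennreal (s * t) \<partial>?M w)"
      if "\<bar>s\<bar> = 1" for s :: real
      using fin[OF v(1) that] fin[OF w(1) that] by (subst int) (simp_all add: enn2real_plus)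
    have L: "(LINT t|?M x. t) =
        enn2real (\<integral>\<^sup>+t. ennreal (1 * t) \<partial>?M x) - enn2real (\<integral>\<^sup>+t. ennreal ((-1) * t) \<partial>?M x)"
      if "x \<in> l2" for x
      using real_lebesgue_integral_def[OF T1[OF that]] by simp
    show ?thesis
      unfolding L[OF v(1)] L[OF w(1)] L[OF l2_add[OF v(1) w(1)]]
      using pl[of 1] pl[of "-1"] by linarith
  qed
  then show ?thesis using v w by (simp add: spec_first_moment)
qed

text \<open>
  Ranges of spectral projections reduce \<open>T\<close>: the additivity of first moments removes the cross
  terms \<open>\<langle>v, T w\<rangle> + \<langle>w, T v\<rangle>\<close>, and replacing \<open>w\<close> by \<open>\<i> w\<close> separates the two.
\<close>
lemma spec_reducing:
  assumes B: "B \<in> sets borel" and v: "v \<in> l2" "P B v = v" and w: "w \<in> l2" "P B w = (\<lambda>n. 0)"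
  shows "l2_inner v (T w) = 0"
proof -
  have Tl: "T x \<in> l2" "T (\<lambda>n. c * x n) = (\<lambda>n. c * T x n)" if "x \<in> l2" for x c
    using T that by (auto simp: bounded_op_def)
  have Ta: "T (\<lambda>n. x n + y n) = (\<lambda>n. T x n + T y n)" if "x \<in> l2" "y \<in> l2" for x y
    using T that by (auto simp: bounded_op_def)
  have "l2_inner v (T w) + l2_inner w (T v) = 0" if w: "w \<in> l2" "P B w = (\<lambda>n. 0)" for w
    using scalar_measure_orth[OF B v w] v w Tl
    by (simp add: Ta l2_inner_add_left l2_inner_add_right)
  from this[OF w] this[of "\<lambda>n. \<i> * w n"] show ?thesis
    using w v B spec_proj[OF B] by (simp add: Tl l2_inner_scale_left l2_inner_scale_right
       orth_projection_def bounded_op_def algebra_simps)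
qed

lemma spec_upper:
  assumes "u \<in> l2" "P {b<..} u = (\<lambda>n. 0)"
  shows "Re (l2_inner u (T u)) \<le> b * (l2_norm u)\<^sup>2"
proof -
  interpret finite_measure "scalar_measure P u" using assms(1) by (rule finite_scalar_measure)
  have meas: "measure (scalar_measure P u) UNIV = (l2_norm u)\<^sup>2"
    using assms by (simp add: measure_scalar_measure spec_UNIV)
  have "AE t in scalar_measure P u. t \<notin> {b<..}"
    using assms by (intro AE_not_in) (simp add: null_sets_def emeasure_scalar_measure l2_norm_def)
  then have "AE t in scalar_measure P u. t \<le> b" by (simp add: not_less)
  then have "(LINT t|scalar_measure P u. t) \<le> (LINT t|scalar_measure P u. b)"
    using assms by (intro integral_mono_AE scalar_measure_integrable) auto
  also have "\<dots> = b * (l2_norm u)\<^sup>2"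
    using meas by simp
  finally show ?thesis using assms by (simp add: spec_first_moment)
qed

lemma spec_lower:
  assumes "u \<in> l2" "P {..<a} u = (\<lambda>n. 0)"
  shows "a * (l2_norm u)\<^sup>2 \<le> Re (l2_inner u (T u))"
proof -
  interpret finite_measure "scalar_measure P u" using assms(1) by (rule finite_scalar_measure)
  have meas: "measure (scalar_measure P u) UNIV = (l2_norm u)\<^sup>2"
    using assms by (simp add: measure_scalar_measure spec_UNIV)
  have "AE t in scalar_measure P u. t \<notin> {..<a}"
    using assms by (intro AE_not_in) (simp add: null_sets_def emeasure_scalar_measure l2_norm_def)
  then have "AE t in scalar_measure P u. a \<le> t" by (simp add: not_less)
  then have "(LINT t|scalar_measure P u. a) \<le> (LINT t|scalar_measure P u. t)"
    using assms by (intro integral_mono_AE scalar_measure_integrable) auto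
  moreover have "(LINT t|scalar_measure P u. a) = a * (l2_norm u)\<^sup>2"
    using meas by simp
  ultimately show ?thesis using assms meas by (simp add: spec_first_moment mult.commute)
qed

text \<open>
  With \<open>w = P(B) u\<close>, the reducing property turns \<open>\<langle>w, (T - E) u\<rangle>\<close> into
  \<open>\<langle>w, (T - E) w\<rangle>\<close>. The hypothesis \<open>far\<close> bounds this from below by \<open>\<delta> \<parallel>w\<parallel>\<^sup>2\<close>, and
  Cauchy--Schwarz bounds it from above. For a half-line \<open>B\<close> at distance \<open>\<delta>\<close> from \<open>E\<close> the hypothesis holds.
\<close>
lemma spec_piece_bound:
  assumes B: "B \<in> sets borel" and u: "u \<in> l2" and \<delta>: "\<delta> > 0"
    and far: "\<And>w. w \<in> l2 \<Longrightarrow> P B w = w \<Longrightarrow>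
      \<delta> * (l2_norm w)\<^sup>2 \<le> \<bar>Re (l2_inner w (T w)) - E * (l2_norm w)\<^sup>2\<bar>"
  shows "l2_norm (P B u) \<le> l2_norm (\<lambda>n. T u n - of_real E * u n) / \<delta>"
proof -
  define w where "w = P B u"
  have w: "w \<in> l2" "P B w = w" using B u by (auto simp: w_def spec_idem)
  have Tl: "T x \<in> l2" if "x \<in> l2" for x using T that by (auto simp: bounded_op_def)
  have "P B (\<lambda>n. u n - w n) = (\<lambda>n. 0)"
    using B u w by (simp add: spec_diff w_def[symmetric])
  then have "l2_inner w (T (\<lambda>n. u n - w n)) = 0"
    using B u w by (intro spec_reducing) auto
  then have "l2_inner w (T u) = l2_inner w (T w)"
    using T u w by (simp add: bounded_op_diff l2_inner_diff_right Tl)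
  moreover have "l2_inner w u = l2_inner w w"
    using spec_symmetric[OF B w(1) u] w by (simp add: w_def[symmetric])
  ultimately have "l2_inner w (\<lambda>n. T u n - of_real E * u n) = l2_inner w (T w) - of_real E * l2_inner w w"
    using u w by (simp add: l2_inner_diff_right l2_inner_scale_right Tl)
  then have "\<bar>Re (l2_inner w (T w)) - E * (l2_norm w)\<^sup>2\<bar> \<le> cmod (l2_inner w (\<lambda>n. T u n - of_real E * u n))"
    using abs_Re_le_cmod[of "l2_inner w (\<lambda>n. T u n - of_real E * u n)"]
    by (simp add: l2_inner_self flip: of_real_power)
  also have "\<dots> \<le> l2_norm w * l2_norm (\<lambda>n. T u n - of_real E * u n)"
    using u w Tl by (intro l2_cauchy_schwarz) auto
  finally have "l2_norm w * (\<delta> * l2_norm w) \<le> l2_norm w * l2_norm (\<lambda>n. T u n - of_real E * u n)"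
    using far[OF w] by (simp add: power2_eq_square algebra_simps)
  then have "\<delta> * l2_norm w \<le> l2_norm (\<lambda>n. T u n - of_real E * u n)"
    by (cases "l2_norm w = 0") (auto simp: order_less_le)
  then show ?thesis using \<delta> by (simp add: w_def field_simps)
qed

text \<open>
  An approximate eigenvector for a value inside an open interval nearly lies in the range of the
  spectral projection on the interval: the complement consists of two half-lines, and
  \<open>spec_piece_bound\<close> applies to each. This is done separately because \<open>T - E\<close> has a definite sign on
  each of them but not on their union.
\<close>
lemma spec_localisation:
  assumes u: "u \<in> l2" and E: "a < E" "E < b"
  shows "l2_norm (\<lambda>n. u n - P {a<..<b} u n) \<le>
    (1 / (E - a) + 1 / (b - E)) * l2_norm (\<lambda>n. T u n - of_real E * u n)"
proof -
  let ?r = "l2_norm (\<lambda>n. T u n - of_real E * u n)"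
  have lo: "l2_norm (P {..a} u) \<le> ?r / (E - a)"
  proof (rule spec_piece_bound)
    fix w assume w: "w \<in> l2" "P {..a} w = w"
    have "P {a<..} (P {..a} w) = (\<lambda>n. 0)"
      using w by (intro spec_compl_zero) auto
    then have "Re (l2_inner w (T w)) \<le> a * (l2_norm w)\<^sup>2"
      using w by (intro spec_upper) auto
    then show "(E - a) * (l2_norm w)\<^sup>2 \<le> \<bar>Re (l2_inner w (T w)) - E * (l2_norm w)\<^sup>2\<bar>"
      by (simp add: algebra_simps)
  qed (use u E in auto)
  have hi: "l2_norm (P {b..} u) \<le> ?r / (b - E)"
  proof (rule spec_piece_bound)
    fix w assume w: "w \<in> l2" "P {b..} w = w"
    have "P {..<b} (P {b..} w) = (\<lambda>n. 0)"
      using w by (intro spec_compl_zero) auto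
    then have "b * (l2_norm w)\<^sup>2 \<le> Re (l2_inner w (T w))"
      using w by (intro spec_lower) auto
    then show "(b - E) * (l2_norm w)\<^sup>2 \<le> \<bar>Re (l2_inner w (T w)) - E * (l2_norm w)\<^sup>2\<bar>"
      by (simp add: algebra_simps)
  qed (use u E in auto)
  define d where "d = (\<lambda>n. u n - (P {a<..<b} u n + (P {..a} u n + P {b..} u n)))"
  have "l2_inner v u = l2_inner v (P {a<..<b} u) + (l2_inner v (P {..a} u) + l2_inner v (P {b..} u))"
    if "v \<in> l2" for v
  proof -
    have "l2_inner v (P ({a<..<b} \<union> ({..a} \<union> {b..})) u) =
        l2_inner v (P {a<..<b} u) + l2_inner v (P ({..a} \<union> {b..}) u)"
      using u E that by (intro spec_Un) auto
    also have "l2_inner v (P ({..a} \<union> {b..}) u) = l2_inner v (P {..a} u) + l2_inner v (P {b..} u)"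
      using u E that by (intro spec_Un) auto
    also have "{a<..<b} \<union> ({..a} \<union> {b..}) = UNIV" by auto
    finally show ?thesis using u by (simp add: spec_UNIV)
  qed
  then have "l2_inner v d = 0" if "v \<in> l2" for v
    unfolding d_def using u that by (simp add: l2_inner_diff_right l2_inner_add_right)
  moreover have "d \<in> l2" unfolding d_def using u by auto
  ultimately have "l2_norm d = 0" using l2_inner_self[of d] by simp
  then have "d = (\<lambda>n. 0)" using \<open>d \<in> l2\<close> by (intro l2_norm_eq_0)
  then have "(\<lambda>n. u n - P {a<..<b} u n) = (\<lambda>n. P {..a} u n + P {b..} u n)"
    unfolding d_def by (auto simp: fun_eq_iff algebra_simps)
  then have "l2_norm (\<lambda>n. u n - P {a<..<b} u n) \<le> l2_norm (P {..a} u) + l2_norm (P {b..} u)"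
    using u by (simp add: l2_norm_triangle)
  with lo hi show ?thesis by (simp add: algebra_simps)
qed

end

section \<open>The Laplacian and its commutators as lattice convolutions\<close>

lemma fin_supp_add: "u \<in> fin_supp \<Longrightarrow> v \<in> fin_supp \<Longrightarrow> (\<lambda>n. u n + v n) \<in> fin_supp"
  unfolding fin_supp_def mem_Collect_eq
  by (rule finite_subset[of _ "{n. u n \<noteq> 0} \<union> {n. v n \<noteq> 0}"]) auto

lemma fin_supp_diff: "u \<in> fin_supp \<Longrightarrow> v \<in> fin_supp \<Longrightarrow> (\<lambda>n. u n - v n) \<in> fin_supp"
  unfolding fin_supp_def mem_Collect_eq
  by (rule finite_subset[of _ "{n. u n \<noteq> 0} \<union> {n. v n \<noteq> 0}"]) auto

lemma fin_supp_mult: "u \<in> fin_supp \<Longrightarrow> (\<lambda>n. f n * u n) \<in> fin_supp"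
  unfolding fin_supp_def mem_Collect_eq by (rule finite_subset[of _ "{n. u n \<noteq> 0}"]) auto

lemma fin_supp_translate: "u \<in> fin_supp \<Longrightarrow> (\<lambda>n. u (n + k)) \<in> fin_supp"
proof -
  assume "u \<in> fin_supp"
  then have "finite ((\<lambda>n. n + k) -` {n. u n \<noteq> 0})"
    unfolding fin_supp_def by (intro finite_vimageI) auto
  then show ?thesis by (simp add: fin_supp_def vimage_def)
qed

lemma vector2_add: "vector [a, b] + vector [c, d] = (vector [a + c, b + d] :: int ^ 2)"
  by (simp add: vec_eq_iff forall_2)

lemma add_vector2_add: "n + vector [a, b] + vector [c, d] = n + (vector [a + c, b + d] :: int ^ 2)"
  by (simp add: vec_eq_iff forall_2)

lemma MV_laplacian_vector:
  "MV_laplacian u n = (u (n + vector [1, 1]) + u (n + vector [1, -1]) +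
      u (n + vector [-1, 1]) + u (n + vector [-1, -1])) / 4" for u :: "2 lattice_fun"
proof -
  have "n + axis 1 1 + axis 2 1 = n + vector [1, 1]" "n + axis 1 1 - axis 2 1 = n + vector [1, -1]"
    "n - axis 1 1 + axis 2 1 = n + vector [-1, 1]" "n - axis 1 1 - axis 2 1 = n + vector [-1, -1]"
    for n :: "int ^ 2"
    by (simp_all add: vec_eq_iff forall_2 axis_def)
  then show ?thesis by (simp only: MV_laplacian_2)
qed

lemma conj_op_vector:
  "conj_op k u n = (1 / (4 * \<i>)) *
    (of_int (2 * n $ 1 - int k) * u (n + vector [- int k, 0])
      - of_int (2 * n $ 1 + int k) * u (n + vector [int k, 0])
      + of_int (2 * n $ 2 - int k) * u (n + vector [0, - int k])
      - of_int (2 * n $ 2 + int k) * u (n + vector [0, int k]))" for u :: "2 lattice_fun"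
proof -
  have ax: "n - axis 1 c = n + vector [- c, 0]" "n - axis 2 c = n + vector [0, - c]"
    for n :: "int ^ 2" and c
    by (simp_all add: vec_eq_iff forall_2 axis_def)
  show ?thesis
    unfolding conj_op_def conj_op_dir_def Let_def shift_def position_def sum_2 ax
    by (simp add: field_simps)
qed

lemma MV_laplacian_fin_supp: "u \<in> fin_supp \<Longrightarrow> MV_laplacian u \<in> fin_supp" for u :: "2 lattice_fun"
proof -
  assume u: "u \<in> fin_supp"
  have "(\<lambda>n. (1 / 4) * (u (n + vector [1, 1]) + u (n + vector [1, -1]) +
      u (n + vector [-1, 1]) + u (n + vector [-1, -1]))) \<in> fin_supp"
    using u by (intro fin_supp_mult fin_supp_add fin_supp_translate)
  moreover have "MV_laplacian u = (\<lambda>n. (1 / 4) * (u (n + vector [1, 1]) + u (n + vector [1, -1]) +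
      u (n + vector [-1, 1]) + u (n + vector [-1, -1])))"
    by (rule ext) (simp add: MV_laplacian_vector)
  ultimately show ?thesis by simp
qed

lemma conj_op_fin_supp: "u \<in> fin_supp \<Longrightarrow> conj_op k u \<in> fin_supp" for u :: "2 lattice_fun"
proof -
  assume u: "u \<in> fin_supp"
  have "(\<lambda>n. (1 / (4 * \<i>)) *
    (of_int (2 * n $ 1 - int k) * u (n + vector [- int k, 0])
      - of_int (2 * n $ 1 + int k) * u (n + vector [int k, 0])
      + of_int (2 * n $ 2 - int k) * u (n + vector [0, - int k])
      - of_int (2 * n $ 2 + int k) * u (n + vector [0, int k]))) \<in> fin_supp"
    using u by (intro fin_supp_mult fin_supp_add fin_supp_diff fin_supp_translate)
  moreover have "conj_op k u = (\<lambda>n. (1 / (4 * \<i>)) *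
    (of_int (2 * n $ 1 - int k) * u (n + vector [- int k, 0])
      - of_int (2 * n $ 1 + int k) * u (n + vector [int k, 0])
      + of_int (2 * n $ 2 - int k) * u (n + vector [0, - int k])
      - of_int (2 * n $ 2 + int k) * u (n + vector [0, int k])))"
    by (rule ext) (rule conj_op_vector)
  ultimately show ?thesis by simp
qed

lemma bounded_op_MV_laplacian: "bounded_op (MV_laplacian :: 2 operator)"
  unfolding bounded_op_def
proof (intro conjI ballI allI exI[of _ 1])
  fix u v :: "2 lattice_fun" and c assume u: "u \<in> l2"
  have eq: "MV_laplacian u = (\<lambda>n. (1 / 4) * (u (n + vector [1, 1]) + u (n + vector [1, -1]) +
      u (n + vector [-1, 1]) + u (n + vector [-1, -1])))"
    by (rule ext) (simp add: MV_laplacian_vector)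
  show "MV_laplacian u \<in> l2"
    unfolding eq using u by (intro l2_scale l2_add l2_translate)
  show "MV_laplacian (\<lambda>n. u n + v n) = (\<lambda>n. MV_laplacian u n + MV_laplacian v n)"
    by (rule ext) (simp add: MV_laplacian_vector add_divide_distrib)
  show "MV_laplacian (\<lambda>n. c * u n) = (\<lambda>n. c * MV_laplacian u n)"
    by (rule ext) (simp add: MV_laplacian_vector algebra_simps)
  have "l2_norm (MV_laplacian u) = 1 / 4 * l2_norm (\<lambda>n. u (n + vector [1, 1]) + u (n + vector [1, -1]) +
      u (n + vector [-1, 1]) + u (n + vector [-1, -1]))"
    unfolding eq l2_norm_scale by simp
  also have "\<dots> \<le> 1 / 4 * (l2_norm (\<lambda>n. u (n + vector [1, 1])) + l2_norm (\<lambda>n. u (n + vector [1, -1])) +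
      l2_norm (\<lambda>n. u (n + vector [-1, 1])) + l2_norm (\<lambda>n. u (n + vector [-1, -1])))"
    by (intro mult_left_mono order_trans[OF l2_norm_triangle] add_right_mono)
       (intro l2_add l2_translate u order_refl zero_le_divide_1_iff[THEN iffD2] zero_le_numeral)+
  finally show "l2_norm (MV_laplacian u) \<le> 1 * l2_norm u"
    by (simp add: l2_norm_translate)
qed

text \<open>
  The bounded extension of \<open>[D, \<i>A\<^sub>k]\<close>: the unbounded position factors cancel, and what remains is
  a combination of sixteen translations with coefficients \<open>\<plusminus>1/8\<close>.
\<close>
definition MV_commutator :: "int \<Rightarrow> 2 operator" where
  "MV_commutator k u n = (\<Sum>a\<in>{1, -1}. \<Sum>b\<in>{1, -1}. \<Sum>s\<in>{1, -1}.
     of_int (- s * a) / 8 * u (n + vector [a + s * k, b]) +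
     of_int (- s * b) / 8 * u (n + vector [a, b + s * k]))"

lemma MV_commutator_eq:
  "MV_laplacian (\<lambda>m. \<i> * conj_op k u m) n - \<i> * conj_op k (MV_laplacian u) n =
    MV_commutator (int k) u n"
  unfolding MV_laplacian_vector conj_op_vector MV_commutator_def add_vector2_add
  by (simp add: field_simps)

lemma MV_commutator_l2: "u \<in> l2 \<Longrightarrow> MV_commutator k u \<in> l2"
  unfolding MV_commutator_def by (intro l2_sum l2_add l2_scale l2_translate)

lemma MV_commutator_norm:
  assumes u: "u \<in> l2" shows "l2_norm (MV_commutator k u) \<le> 2 * l2_norm u"
proof -
  have "l2_norm (MV_commutator k u) \<le> (\<Sum>a\<in>{1, -1::int}. \<Sum>b\<in>{1, -1::int}. \<Sum>s\<in>{1, -1::int}.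
     l2_norm (\<lambda>n. of_int (- s * a) / 8 * u (n + vector [a + s * k, b]) +
     of_int (- s * b) / 8 * u (n + vector [a, b + s * k])))"
    unfolding MV_commutator_def using u
    by (intro order_trans[OF l2_norm_sum] sum_mono l2_sum l2_add l2_scale l2_translate order_refl)
  also have "\<dots> \<le> (\<Sum>a\<in>{1, -1::int}. \<Sum>b\<in>{1, -1::int}. \<Sum>s\<in>{1, -1::int}. l2_norm u / 4)"
  proof (intro sum_mono)
    fix a b s :: int assume *: "a \<in> {1, -1}" "b \<in> {1, -1}" "s \<in> {1, -1}"
    have "l2_norm (\<lambda>n. of_int (- s * a) / 8 * u (n + vector [a + s * k, b]) +
         of_int (- s * b) / 8 * u (n + vector [a, b + s * k]))
       \<le> l2_norm (\<lambda>n. of_int (- s * a) / 8 * u (n + vector [a + s * k, b])) +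
         l2_norm (\<lambda>n. of_int (- s * b) / 8 * u (n + vector [a, b + s * k]))"
      using u by (intro l2_norm_triangle l2_scale l2_translate)
    also have "\<dots> = l2_norm u / 4"
      unfolding l2_norm_scale l2_norm_translate using * by (auto simp: norm_divide)
    finally show "l2_norm (\<lambda>n. of_int (- s * a) / 8 * u (n + vector [a + s * k, b]) +
         of_int (- s * b) / 8 * u (n + vector [a, b + s * k])) \<le> l2_norm u / 4" .
  qed
  finally show ?thesis by simp
qed

text \<open>
  The contribution of one coordinate to the symbol: the polynomial form of \<open>sin t * sin (k t)\<close> in
  \<open>cos t\<close>, for \<open>k \<ge> 1\<close>.
\<close>
definition cheb_sin :: "nat \<Rightarrow> real \<Rightarrow> real" where
  "cheb_sin k x = (1 - x\<^sup>2) * poly (cheb_U (k - 1)) x"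

lemma cheb_sin_cos:
  assumes "k \<ge> 1" shows "cheb_sin k (cos t) = sin t * sin (real k * t)"
proof -
  have "cheb_sin k (cos t) = sin t * (poly (cheb_U (k - 1)) (cos t) * sin t)"
    unfolding cheb_sin_def sin_squared_eq[symmetric] by (simp add: power2_eq_square)
  also have "\<dots> = sin t * sin (real k * t)"
    using assms by (simp add: poly_cheb_U_cos del: One_nat_def)
  finally show ?thesis .
qed

lemma g_fun_cheb_sin:
  "g_fun k (x :: real ^ 2) = x $ 2 * cheb_sin k (x $ 1) + x $ 1 * cheb_sin k (x $ 2)"
proof -
  have "UNIV - {1} = {2::2}" "UNIV - {2} = {1::2}" using UNIV_2 by auto
  then show ?thesis unfolding g_fun_def sum_2 by (simp add: cheb_sin_def mult.assoc)
qed

lemma g_fun_cos: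
  fixes x :: "real ^ 2"
  assumes "x $ 1 = cos s" "x $ 2 = cos t" "k \<ge> 1"
  shows "g_fun k x = cos t * (sin s * sin (real k * s)) + cos s * (sin t * sin (real k * t))"
  using assms by (simp add: g_fun_cheb_sin cheb_sin_cos)

lemma cis_pm: "cis x + cis (- x) = of_real (2 * cos x)" "cis x - cis (- x) = of_real (2 * sin x) * \<i>"
  by (simp_all add: complex_eq_iff)

text \<open>
  The Fourier multiplier of \<open>MV_commutator\<close>: the triple sum factorises into differences and sums of
  opposite exponentials, that is, into sines and cosines, and the result is \<open>g_fun\<close> as in
  \<open>g_fun_cos\<close>.
\<close>
lemma MV_commutator_symbol:
  "(\<Sum>a\<in>{1, -1}. \<Sum>b\<in>{1, -1}. \<Sum>r\<in>{1, -1::int}.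
     of_int (- r * a) / 8 * cis (real_of_int (a + r * k) * s + real_of_int b * t) +
     of_int (- r * b) / 8 * cis (real_of_int a * s + real_of_int (b + r * k) * t)) =
   of_real (cos t * (sin s * sin (of_int k * s)) + cos s * (sin t * sin (of_int k * t)))"
proof -
  define S T SK TK where "S = cis s" "T = cis t" "SK = cis (of_int k * s)" "TK = cis (of_int k * t)"
  define S' T' SK' TK' where "S' = cis (-s)" "T' = cis (-t)" "SK' = cis (- (of_int k * s))" "TK' = cis (-(of_int k * t))"
  note d = S_T_SK_TK_def S'_T'_SK'_TK'_def
  have "(\<Sum>a\<in>{1, -1}. \<Sum>b\<in>{1, -1}. \<Sum>r\<in>{1, -1::int}.
     of_int (- r * a) / 8 * cis (real_of_int (a + r * k) * s + real_of_int b * t) +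
     of_int (- r * b) / 8 * cis (real_of_int a * s + real_of_int (b + r * k) * t)) =
    - ((S - S') * (T + T') * (SK - SK') + (T - T') * (S + S') * (TK - TK')) / 8"
    unfolding d by (simp add: cis_mult algebra_simps add_divide_distrib diff_divide_distrib)
  also have "\<dots> = of_real (cos t * (sin s * sin (of_int k * s)) + cos s * (sin t * sin (of_int k * t)))"
    unfolding d cis_pm by (simp add: complex_eq_iff)
  finally show ?thesis .
qed

section \<open>Plane-wave packets\<close>

lemma int2_box_bij:
  "bij_betw (\<lambda>n :: int ^ 2. (n $ 1, n $ 2)) {n. n $ 1 \<in> A \<and> n $ 2 \<in> B} (A \<times> B)"
  by (rule bij_betw_byWitness[of _ "\<lambda>(a, b). vector [a, b]"]) (auto simp: vec_eq_iff forall_2)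

lemma card_int2_box: "card {n :: int ^ 2. n $ 1 \<in> A \<and> n $ 2 \<in> B} = card A * card B"
  using bij_betw_same_card[OF int2_box_bij] by (simp add: card_cartesian_product)

lemma finite_int2_box:
  "finite A \<Longrightarrow> finite B \<Longrightarrow> finite {n :: int ^ 2. n $ 1 \<in> A \<and> n $ 2 \<in> B}"
  using bij_betw_finite[OF int2_box_bij] by simp

lemma overlap_ratio_tendsto: "(\<lambda>L. real (nat (int (Suc L) - \<bar>a\<bar>)) / real (Suc L)) \<longlonglongrightarrow> 1"
proof -
  have "(\<lambda>L. 1 - \<bar>real_of_int a\<bar> * inverse (real (Suc L))) \<longlonglongrightarrow> 1 - \<bar>real_of_int a\<bar> * 0"
    by (intro tendsto_intros LIMSEQ_inverse_real_of_nat)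
  moreover have "\<forall>\<^sub>F L in sequentially. 1 - \<bar>real_of_int a\<bar> * inverse (real (Suc L)) =
      real (nat (int (Suc L) - \<bar>a\<bar>)) / real (Suc L)"
    using eventually_ge_at_top[of "nat \<bar>a\<bar>"]
    by eventually_elim (simp add: field_simps)
  ultimately show ?thesis by (simp add: filterlim_cong tendsto_cong)
qed

text \<open>
  The packet is the plane wave cut off to a square of side \<open>L + 1\<close> and normalised. Its correlation
  with a translate is the phase of the translation times the relative size of the overlap of the
  square with its translate, which tends to one. Every other asymptotic property of the packets
  follows from these correlations.
\<close>
lemma plane_wave_packets:
  fixes s t :: real
  obtains v :: "nat \<Rightarrow> 2 lattice_fun" where "\<And>L. v L \<in> fin_supp" "\<And>L. l2_norm (v L) = 1"
    "\<And>a b. (\<lambda>L. l2_inner (v L) (\<lambda>n. v L (n + vector [a, b]))) \<longlonglongrightarrow> cis (of_int a * s + of_int b * t)"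
proof -
  define box where "box L = {n :: int ^ 2. n $ 1 \<in> {0..<int (Suc L)} \<and> n $ 2 \<in> {0..<int (Suc L)}}" for L
  define v where "v L n = (if n \<in> box L then cis (of_int (n $ 1) * s + of_int (n $ 2) * t) / of_nat (Suc L) else 0)"
    for L n
  have fin: "finite (box L)" for L unfolding box_def by (rule finite_int2_box) auto
  have corr: "l2_inner (v L) (\<lambda>n. v L (n + vector [a, b])) =
      of_real (real (nat (int (Suc L) - \<bar>a\<bar>)) / real (Suc L) * (real (nat (int (Suc L) - \<bar>b\<bar>)) / real (Suc L)))
        * cis (of_int a * s + of_int b * t)" for L a b
  proof -
    let ?B = "{n :: int ^ 2. n $ 1 \<in> {max 0 (- a)..<min (int (Suc L)) (int (Suc L) - a)} \<and>
                n $ 2 \<in> {max 0 (- b)..<min (int (Suc L)) (int (Suc L) - b)}}"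
    have "l2_inner (v L) (\<lambda>n. v L (n + vector [a, b])) = (\<Sum>n\<in>box L. cnj (v L n) * v L (n + vector [a, b]))"
      by (rule l2_inner_fin_supp) (auto simp: fin v_def)
    also have "\<dots> = (\<Sum>n\<in>?B. cnj (v L n) * v L (n + vector [a, b]))"
    proof (rule sum.mono_neutral_right[OF fin])
      have B: "n \<in> ?B \<longleftrightarrow> n \<in> box L \<and> n + vector [a, b] \<in> box L" for n
        by (auto simp: box_def)
      show "?B \<subseteq> box L" using B by blast
      show "\<forall>n\<in>box L - ?B. cnj (v L n) * v L (n + vector [a, b]) = 0"
      proof
        fix n assume "n \<in> box L - ?B"
        then have "n + vector [a, b] \<notin> box L" using B by blast
        then have "v L (n + vector [a, b]) = 0" by (simp add: v_def)
        then show "cnj (v L n) * v L (n + vector [a, b]) = 0" by simp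
      qed
    qed
    also have "\<dots> = (\<Sum>n\<in>?B. cis (of_int a * s + of_int b * t) / (of_nat (Suc L))\<^sup>2)"
    proof (rule sum.cong[OF refl])
      fix n assume n: "n \<in> ?B"
      then have "n \<in> box L" "n + vector [a, b] \<in> box L" by (auto simp: box_def)
      then show "cnj (v L n) * v L (n + vector [a, b]) = cis (of_int a * s + of_int b * t) / (of_nat (Suc L))\<^sup>2"
        by (simp add: v_def cis_cnj cis_mult power2_eq_square algebra_simps)
    qed
    also have "\<dots> = of_nat (card ?B) * (cis (of_int a * s + of_int b * t) / (of_nat (Suc L))\<^sup>2)" by simp
    also have "card ?B = nat (int (Suc L) - \<bar>a\<bar>) * nat (int (Suc L) - \<bar>b\<bar>)"
    proof -
      have "min (int (Suc L)) (int (Suc L) - c) - max 0 (- c) = int (Suc L) - \<bar>c\<bar>" for c by auto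
      then show ?thesis unfolding card_int2_box by simp
    qed
    finally show ?thesis by (simp add: power2_eq_square)
  qed
  have "v L \<in> fin_supp" for L
    unfolding fin_supp_def mem_Collect_eq by (rule finite_subset[OF _ fin[of L]]) (auto simp: v_def)
  moreover have "l2_norm (v L) = 1" for L
  proof -
    have z: "vector [0, 0] = (0 :: int ^ 2)" by (simp add: vec_eq_iff forall_2)
    have "complex_of_real ((l2_norm (v L))\<^sup>2) = 1"
      using corr[of L 0 0] unfolding z by (simp add: l2_inner_self del: of_real_power)
    then have "(l2_norm (v L))\<^sup>2 = 1" by (simp only: of_real_eq_1_iff)
    then show ?thesis using l2_norm_ge_0[of "v L"] by (simp add: power2_eq_1_iff)
  qed
  moreover have "(\<lambda>L. l2_inner (v L) (\<lambda>n. v L (n + vector [a, b]))) \<longlonglongrightarrow> cis (of_int a * s + of_int b * t)" for a b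
  proof -
    have "(\<lambda>L. l2_inner (v L) (\<lambda>n. v L (n + vector [a, b]))) \<longlonglongrightarrow> of_real (1 * 1) * cis (of_int a * s + of_int b * t)"
      unfolding corr by (intro tendsto_intros overlap_ratio_tendsto)
    then show ?thesis by simp
  qed
  ultimately show ?thesis by (rule that)
qed

text \<open>
  For unit vectors \<open>\<parallel>\<tau>v - z v\<parallel>\<^sup>2 = 2 - 2 Re (z * cnj \<langle>v, \<tau>v\<rangle>)\<close>, and the right-hand side tends to
  \<open>2 - 2 |z|\<^sup>2 = 0\<close>.
\<close>
lemma packet_translate_eigen:
  assumes v: "\<And>L. v L \<in> fin_supp" "\<And>L::nat. l2_norm (v L) = 1"
    and lim: "(\<lambda>L. l2_inner (v L) (\<lambda>n. v L (n + k))) \<longlonglongrightarrow> z" and z: "cmod z = 1"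
  shows "(\<lambda>L. l2_norm (\<lambda>n. v L (n + k) - z * v L n)) \<longlonglongrightarrow> 0"
proof -
  have l2: "v L \<in> l2" for L using v fin_supp_l2 by blast
  have sq: "(l2_norm (\<lambda>n. v L (n + k) - z * v L n))\<^sup>2 =
      2 - 2 * Re (z * cnj (l2_inner (v L) (\<lambda>n. v L (n + k))))" for L
  proof -
    have "(l2_norm (\<lambda>n. v L (n + k) + (- z) * v L n))\<^sup>2 =
        (l2_norm (\<lambda>n. v L (n + k)))\<^sup>2 + 2 * Re (l2_inner (\<lambda>n. v L (n + k)) (\<lambda>n. (- z) * v L n)) +
        (l2_norm (\<lambda>n. (- z) * v L n))\<^sup>2"
      using l2 by (intro l2_norm_add_sq l2_translate l2_scale)
    also have "l2_inner (\<lambda>n. v L (n + k)) (\<lambda>n. (- z) * v L n) =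
        (- z) * cnj (l2_inner (v L) (\<lambda>n. v L (n + k)))"
      unfolding l2_inner_scale_right using l2_inner_commute by metis
    finally show ?thesis
      unfolding l2_norm_scale l2_norm_translate by (simp add: v z)
  qed
  have "(\<lambda>L. 2 - 2 * Re (z * cnj (l2_inner (v L) (\<lambda>n. v L (n + k))))) \<longlonglongrightarrow> 2 - 2 * Re (z * cnj z)"
    by (intro tendsto_intros lim)
  also have "z * cnj z = 1" using complex_norm_square[of z] z by simp
  finally have "(\<lambda>L. (l2_norm (\<lambda>n. v L (n + k) - z * v L n))\<^sup>2) \<longlonglongrightarrow> 0"
    unfolding sq by simp
  from tendsto_real_sqrt[OF this] show ?thesis by simp
qed

lemma packet_MV_eigen:
  fixes v :: "nat \<Rightarrow> 2 lattice_fun"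
  assumes v: "\<And>L. v L \<in> fin_supp" "\<And>L::nat. l2_norm (v L) = 1"
    and lim: "\<And>a b. (\<lambda>L. l2_inner (v L) (\<lambda>n. v L (n + vector [a, b]))) \<longlonglongrightarrow> cis (of_int a * s + of_int b * t)"
  shows "(\<lambda>L. l2_norm (\<lambda>n. MV_laplacian (v L) n - of_real (cos s * cos t) * v L n)) \<longlonglongrightarrow> 0"
proof -
  define I where "I = {1, -1 :: int} \<times> {1, -1 :: int}"
  define r where "r L ab n = v L (n + vector [fst ab, snd ab]) -
      cis (of_int (fst ab) * s + of_int (snd ab) * t) * v L n" for L ab n
  have l2: "v L \<in> l2" for L using v fin_supp_l2 by blast
  have r_l2: "r L ab \<in> l2" for L ab
    unfolding r_def using l2 by (intro l2_diff l2_translate l2_scale)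
  have rsum: "(\<Sum>ab\<in>I. f ab) = f (1,1) + f (1,-1) + f (-1,1) + f (-1,-1)" for f :: "_ \<Rightarrow> 'z::comm_monoid_add"
    unfolding I_def by (simp add: sum.cartesian_product[symmetric, of "\<lambda>a b. f (a, b)", simplified] add.assoc)
  have cs: "cis (s + t) + cis (s - t) + cis (t - s) + cis (- s - t) = of_real (4 * (cos s * cos t))"
    by (simp add: complex_eq_iff cos_add cos_diff sin_add sin_diff)
  have eq: "(\<lambda>n. MV_laplacian (v L) n - of_real (cos s * cos t) * v L n) = (\<lambda>n. \<Sum>ab\<in>I. (1 / 4) * r L ab n)" for L
  proof
    fix n
    define z where "z = complex_of_real (cos s * cos t)"
    have z: "z = (cis (s + t) + cis (s - t) + cis (t - s) + cis (- s - t)) / 4"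
      unfolding cs z_def by simp
    show "MV_laplacian (v L) n - of_real (cos s * cos t) * v L n = (\<Sum>ab\<in>I. (1 / 4) * r L ab n)"
      unfolding rsum MV_laplacian_vector z_def[symmetric] by (simp add: z r_def field_simps)
  qed
  have "(\<lambda>L. \<Sum>ab\<in>I. (1 / 4) * l2_norm (r L ab)) \<longlonglongrightarrow> (\<Sum>ab\<in>I. (1 / 4) * 0)"
    unfolding r_def by (intro tendsto_intros packet_translate_eigen v lim) simp_all
  then have lim0: "(\<lambda>L. \<Sum>ab\<in>I. (1 / 4) * l2_norm (r L ab)) \<longlonglongrightarrow> 0" by simp
  show ?thesis
  proof (rule Lim_null_comparison[OF always_eventually lim0], rule allI)
    fix L
    have "l2_norm (\<lambda>n. \<Sum>ab\<in>I. (1 / 4) * r L ab n) \<le> (\<Sum>ab\<in>I. l2_norm (\<lambda>n. (1 / 4) * r L ab n))"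
      using r_l2 by (intro l2_norm_sum l2_scale)
    then show "norm (l2_norm (\<lambda>n. MV_laplacian (v L) n - of_real (cos s * cos t) * v L n))
        \<le> (\<Sum>ab\<in>I. (1 / 4) * l2_norm (r L ab))"
      unfolding eq l2_norm_scale by simp
  qed
qed

lemma packet_commutator_limit:
  assumes v: "\<And>L::nat. v L \<in> fin_supp"
    and lim: "\<And>a b. (\<lambda>L. l2_inner (v L) (\<lambda>n. v L (n + vector [a, b]))) \<longlonglongrightarrow> cis (of_int a * s + of_int b * t)"
    and x: "x $ 1 = cos s" "x $ 2 = cos t" and k: "k \<ge> 1"
  shows "(\<lambda>L. l2_inner (v L) (MV_commutator (int k) (v L))) \<longlonglongrightarrow> of_real (g_fun k (x :: real ^ 2))"
proof -
  have l2: "v L \<in> l2" for L using v fin_supp_l2 by blast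
  have eq: "l2_inner (v L) (MV_commutator (int k) (v L)) =
    (\<Sum>a\<in>{1, -1::int}. \<Sum>b\<in>{1, -1}. \<Sum>r\<in>{1, -1}.
     of_int (- r * a) / 8 * l2_inner (v L) (\<lambda>n. v L (n + vector [a + r * int k, b])) +
     of_int (- r * b) / 8 * l2_inner (v L) (\<lambda>n. v L (n + vector [a, b + r * int k])))" for L
  proof -
    have t: "(\<lambda>n. v L (n + m)) \<in> l2" for m using l2 by (rule l2_translate)
    have inner: "l2_inner (v L) (\<lambda>n. c * v L (n + m) + d * v L (n + m')) =
      c * l2_inner (v L) (\<lambda>n. v L (n + m)) + d * l2_inner (v L) (\<lambda>n. v L (n + m'))" for c d m m'
      by (subst l2_inner_add_right) (intro l2 l2_scale t | simp only: l2_inner_scale_right)+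
    have tt: "(\<lambda>n. c * v L (n + m) + d * v L (n + m')) \<in> l2" for c d m m'
      by (intro l2_add l2_scale t)
    have "l2_inner (v L) (MV_commutator (int k) (v L)) =
      (\<Sum>a\<in>{1, -1::int}. \<Sum>b\<in>{1, -1}. \<Sum>r\<in>{1, -1}. l2_inner (v L) (\<lambda>n.
       of_int (- r * a) / 8 * v L (n + vector [a + r * int k, b]) +
       of_int (- r * b) / 8 * v L (n + vector [a, b + r * int k])))"
      unfolding MV_commutator_def
      by ((subst l2_inner_sum_right, intro l2, intro l2_sum tt, rule sum.cong[OF refl])+, rule refl)
    then show ?thesis unfolding inner .
  qed
  have "(\<lambda>L. l2_inner (v L) (MV_commutator (int k) (v L))) \<longlonglongrightarrow>
     (\<Sum>a\<in>{1, -1::int}. \<Sum>b\<in>{1, -1}. \<Sum>r\<in>{1, -1}.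
     of_int (- r * a) / 8 * cis (of_int (a + r * int k) * s + of_int b * t) +
     of_int (- r * b) / 8 * cis (of_int a * s + of_int (b + r * int k) * t))"
    unfolding eq by (intro tendsto_intros lim)
  then show ?thesis
    unfolding MV_commutator_symbol g_fun_cos[OF x k] by simp
qed

text \<open>
  A bounded inverse of \<open>D - E\<close> would bound the norm one of the packets by a multiple of their
  vanishing residuals. The angles \<open>(arccos E, 0)\<close> give the value \<open>E\<close>.
\<close>
lemma MV_spectrum:
  assumes "E \<in> {-1..1}" shows "E \<in> sigma_D TYPE(2)"
proof -
  obtain v :: "nat \<Rightarrow> 2 lattice_fun" where v: "\<And>L. v L \<in> fin_supp" "\<And>L. l2_norm (v L) = 1"
    "\<And>a b. (\<lambda>L. l2_inner (v L) (\<lambda>n. v L (n + vector [a, b]))) \<longlonglongrightarrow> cis (of_int a * arccos E + of_int b * 0)"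
    using plane_wave_packets[of "arccos E" 0] by blast
  have l2: "v L \<in> l2" for L using v fin_supp_l2 by blast
  have "(\<lambda>L. l2_norm (\<lambda>n. MV_laplacian (v L) n - of_real (cos (arccos E) * cos 0) * v L n)) \<longlonglongrightarrow> 0"
    by (rule packet_MV_eigen) (fact v)+
  then have lim: "(\<lambda>L. l2_norm (\<lambda>n. MV_laplacian (v L) n - of_real E * v L n)) \<longlonglongrightarrow> 0"
    using assms by simp
  show ?thesis
    unfolding sigma_D_def spectrum_def mem_Collect_eq
  proof
    assume "\<exists>R. bounded_op R \<and> (\<forall>u\<in>l2. R (\<lambda>n. (MV_laplacian :: 2 operator) u n - of_real E * u n) = u \<and>
      (\<lambda>n. (MV_laplacian :: 2 operator) (R u) n - of_real E * R u n) = u)"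
    then obtain R :: "2 operator" where R: "bounded_op R"
      "\<And>u. u \<in> l2 \<Longrightarrow> R (\<lambda>n. MV_laplacian u n - of_real E * u n) = u" by blast
    obtain K where K: "\<And>u. u \<in> l2 \<Longrightarrow> l2_norm (R u) \<le> K * l2_norm u"
      using R(1) unfolding bounded_op_def by blast
    have "1 \<le> K * l2_norm (\<lambda>n. MV_laplacian (v L) n - of_real E * v L n)" for L
    proof -
      have "(\<lambda>n. MV_laplacian (v L) n - of_real E * v L n) \<in> l2"
        by (intro l2_diff l2_scale bounded_op_l2[OF bounded_op_MV_laplacian] l2)
      from K[OF this] show ?thesis by (simp add: R(2)[OF l2] v)
    qed
    moreover have "(\<lambda>L. K * l2_norm (\<lambda>n. MV_laplacian (v L) n - of_real E * v L n)) \<longlonglongrightarrow> K * 0"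
      by (intro tendsto_intros lim)
    ultimately have "1 \<le> K * 0" by (intro LIMSEQ_le_const) auto
    then show False by simp
  qed
qed

section \<open>Commutators with infinite combinations of the conjugate operators\<close>

lemma lin_comb_pointwise:
  fixes A :: "2 operator"
  assumes "is_lin_comb \<kappa> \<rho> A" "u \<in> fin_supp"
  shows "(\<lambda>M. \<Sum>p = 1..M. of_real (\<rho> (p * \<kappa>)) * conj_op (p * \<kappa>) u n) \<longlonglongrightarrow> A u n"
proof (rule Lim_transform2[OF tendsto_const])
  have A: "A u \<in> l2" and lim: "(\<lambda>M. l2_norm (\<lambda>n. A u n - (\<Sum>p = 1..M. of_real (\<rho> (p * \<kappa>)) * conj_op (p * \<kappa>) u n))) \<longlonglongrightarrow> 0"
    using assms unfolding is_lin_comb_def by auto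
  show "(\<lambda>M. A u n - (\<Sum>p = 1..M. of_real (\<rho> (p * \<kappa>)) * conj_op (p * \<kappa>) u n)) \<longlonglongrightarrow> 0"
  proof (rule Lim_null_comparison[OF always_eventually lim], rule allI)
    fix M
    have "(\<lambda>n. A u n - (\<Sum>p = 1..M. of_real (\<rho> (p * \<kappa>)) * conj_op (p * \<kappa>) u n)) \<in> l2"
      using A assms(2) by (intro l2_diff l2_sum l2_scale fin_supp_l2[OF conj_op_fin_supp])
    from norm_le_l2_norm[OF this]
    show "cmod (A u n - (\<Sum>p = 1..M. of_real (\<rho> (p * \<kappa>)) * conj_op (p * \<kappa>) u n)) \<le>
      l2_norm (\<lambda>n. A u n - (\<Sum>p = 1..M. of_real (\<rho> (p * \<kappa>)) * conj_op (p * \<kappa>) u n))" .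
  qed
qed

text \<open>
  On the delta sequence at the origin, \<open>A\<^sub>k\<close> produces the value \<open>k / (4\<i>)\<close> at \<open>(k, 0)\<close>, and
  different \<open>k\<close> do not interfere. Since \<open>A \<delta>\<close> is square-summable, so is
  \<open>k * \<rho>\<^sub>k\<close>, and Cauchy--Schwarz against \<open>1/k\<close> gives absolute summability. This is what makes the
  symbol series uniformly convergent.
\<close>
lemma lin_comb_coeffs_summable:
  fixes A :: "2 operator"
  assumes "is_lin_comb \<kappa> \<rho> A" "\<kappa> \<ge> 1"
  shows "summable (\<lambda>p. \<bar>\<rho> (Suc p * \<kappa>)\<bar>)"
proof -
  define \<delta> :: "2 lattice_fun" where "\<delta> n = (if n = 0 then 1 else 0)" for n
  have \<delta>: "\<delta> \<in> fin_supp" by (auto simp: fin_supp_def \<delta>_def)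
  define m :: "nat \<Rightarrow> int ^ 2" where "m p = vector [int (Suc p * \<kappa>), 0]" for p
  have conj: "conj_op (q * \<kappa>) \<delta> (m p) =
      (if q = Suc p then of_nat (Suc p * \<kappa>) / (4 * \<i>) else 0)" if "q \<ge> 1" for p q
  proof -
    have z: "vector [a, b] = (0 :: int ^ 2) \<longleftrightarrow> a = 0 \<and> b = 0" for a b
      by (simp add: vec_eq_iff forall_2)
    have "int (Suc p * \<kappa>) - int (q * \<kappa>) = 0 \<longleftrightarrow> q = Suc p"
      using assms(2) by (simp only: right_minus_eq of_nat_eq_iff mult_cancel2) auto
    moreover have "int (Suc p * \<kappa>) + int (q * \<kappa>) \<noteq> 0" "int (Suc p * \<kappa>) \<noteq> 0"
    proof -
      have "0 < int (Suc p * \<kappa>)" "0 \<le> int (q * \<kappa>)" using assms(2) by (simp_all only: of_nat_0_less_iff) auto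
      then show "int (Suc p * \<kappa>) + int (q * \<kappa>) \<noteq> 0" "int (Suc p * \<kappa>) \<noteq> 0" by linarith+
    qed
    ultimately show ?thesis
      unfolding conj_op_vector m_def vector2_add \<delta>_def z by (auto simp: field_simps)
  qed
  have val: "A \<delta> (m p) = of_real (\<rho> (Suc p * \<kappa>)) * (of_nat (Suc p * \<kappa>) / (4 * \<i>))" for p
  proof (rule LIMSEQ_unique[OF lin_comb_pointwise[OF assms(1) \<delta>]])
    have "\<forall>\<^sub>F M in sequentially. (\<Sum>q = 1..M. of_real (\<rho> (q * \<kappa>)) * conj_op (q * \<kappa>) \<delta> (m p)) =
        of_real (\<rho> (Suc p * \<kappa>)) * (of_nat (Suc p * \<kappa>) / (4 * \<i>))"
      using eventually_ge_at_top[of "Suc p"]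
    proof eventually_elim
      case (elim M)
      have "(\<Sum>q = 1..M. of_real (\<rho> (q * \<kappa>)) * conj_op (q * \<kappa>) \<delta> (m p)) =
          (\<Sum>q = 1..M. if q = Suc p then of_real (\<rho> (Suc p * \<kappa>)) * (of_nat (Suc p * \<kappa>) / (4 * \<i>)) else 0)"
        by (intro sum.cong refl) (simp add: conj)
      then show ?case using elim by (simp add: sum.delta)
    qed
    then show "(\<lambda>M. \<Sum>q = 1..M. of_real (\<rho> (q * \<kappa>)) * conj_op (q * \<kappa>) \<delta> (m p)) \<longlonglongrightarrow>
        of_real (\<rho> (Suc p * \<kappa>)) * (of_nat (Suc p * \<kappa>) / (4 * \<i>))"
      by (rule tendsto_eventually)
  qed
  have inj: "inj m"
  proof
    fix p q assume "m p = m q"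
    then have "m p $ 1 = m q $ 1" by simp
    then have "int (Suc p * \<kappa>) = int (Suc q * \<kappa>)" by (simp only: m_def vector_2)
    then show "p = q" using assms(2) by auto
  qed
  have "A \<delta> \<in> l2" using assms(1) \<delta> by (simp add: is_lin_comb_def)
  then have "(\<lambda>n. (cmod (A \<delta> n))\<^sup>2) summable_on range m"
    unfolding l2_iff by (rule summable_on_subset_banach) simp
  then have "(\<lambda>p. (cmod (A \<delta> (m p)))\<^sup>2) summable_on UNIV"
    unfolding summable_on_reindex[OF inj] o_def .
  then have sq: "summable (\<lambda>p. (cmod (A \<delta> (m p)))\<^sup>2)"
    by (rule summable_on_imp_summable)
  have "summable (\<lambda>p. (cmod (A \<delta> (m p)))\<^sup>2 + 16 * (1 / (real (Suc p))\<^sup>2))"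
  proof (intro summable_add sq summable_mult)
    have "summable (\<lambda>n. inverse (real n ^ 2))" by (rule inverse_power_summable) simp
    then have "summable (\<lambda>n. inverse (real (Suc n) ^ 2))" by (subst summable_Suc_iff)
    then show "summable (\<lambda>p. 1 / (real (Suc p))\<^sup>2)" by (simp only: inverse_eq_divide)
  qed
  then show ?thesis
  proof (rule summable_comparison_test'[where N = 0])
    fix p
    define y where "y = cmod (A \<delta> (m p))"
    have y: "y = \<bar>\<rho> (Suc p * \<kappa>)\<bar> * real (Suc p * \<kappa>) / 4"
      unfolding y_def val by (simp add: norm_mult norm_divide flip: of_nat_mult of_nat_Suc del: of_nat_add)
    have "real (Suc p) \<le> real (Suc p * \<kappa>)" using mult_le_mono2[OF assms(2), of "Suc p"] by (intro of_nat_mono) simp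
    then have "\<bar>\<rho> (Suc p * \<kappa>)\<bar> * real (Suc p) / 4 \<le> y"
      unfolding y by (intro divide_right_mono mult_left_mono) auto
    then have "\<bar>\<rho> (Suc p * \<kappa>)\<bar> \<le> y * (4 / real (Suc p))" by (simp add: field_simps)
    \<comment> \<open>The factor 2 prepares for \<open>2 y z \<le> y\<^sup>2 + z\<^sup>2\<close>.\<close>
    also have "\<dots> \<le> 2 * y * (4 / real (Suc p))"
      by (intro mult_right_mono) (simp_all add: y_def)
    also have "\<dots> \<le> y\<^sup>2 + (4 / real (Suc p))\<^sup>2" by (rule sum_squares_bound)
    finally show "norm \<bar>\<rho> (Suc p * \<kappa>)\<bar> \<le> (cmod (A \<delta> (m p)))\<^sup>2 + 16 * (1 / (real (Suc p))\<^sup>2)"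
      by (simp add: y_def power_divide)
  qed
qed

text \<open>
  Pointwise convergence of the partial sums is enough, because \<open>D\<close> only involves four
  neighbouring sites and \<open>u\<close> has finite support.
\<close>
lemma commutator_ext_sums:
  fixes A C :: "2 operator"
  assumes A: "is_lin_comb \<kappa> \<rho> A" and C: "is_commutator_ext MV_laplacian A C" and u: "u \<in> fin_supp"
  shows "(\<lambda>p. of_real (\<rho> (Suc p * \<kappa>)) * l2_inner u (MV_commutator (int (Suc p * \<kappa>)) u)) sums l2_inner u (C u)"
proof -
  have pt: "(\<lambda>p. of_real (\<rho> (Suc p * \<kappa>)) * MV_commutator (int (Suc p * \<kappa>)) u n) sums C u n" for n
  proof -
    define S where "S M w n = (\<Sum>p = 1..M. of_real (\<rho> (p * \<kappa>)) * conj_op (p * \<kappa>) w n)"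
      for M and w :: "2 lattice_fun" and n
    have lim: "(\<lambda>M. S M w n) \<longlonglongrightarrow> A w n" if "w \<in> fin_supp" for w n
      unfolding S_def using A that by (rule lin_comb_pointwise)
    have "(\<lambda>M. MV_laplacian (\<lambda>m. \<i> * S M u m) n - \<i> * S M (MV_laplacian u) n) \<longlonglongrightarrow>
        MV_laplacian (\<lambda>m. \<i> * A u m) n - \<i> * A (MV_laplacian u) n"
      unfolding MV_laplacian_vector[of "\<lambda>m. \<i> * S M u m" for M] MV_laplacian_vector[of "\<lambda>m. \<i> * A u m"]
      by (intro tendsto_intros lim u MV_laplacian_fin_supp) simp
    also have "(\<lambda>M. MV_laplacian (\<lambda>m. \<i> * S M u m) n - \<i> * S M (MV_laplacian u) n) =
        (\<lambda>M. \<Sum>p<M. of_real (\<rho> (Suc p * \<kappa>)) * MV_commutator (int (Suc p * \<kappa>)) u n)"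
    proof
      fix M
      have S: "S M w n = (\<Sum>p<M. of_real (\<rho> (Suc p * \<kappa>)) * conj_op (Suc p * \<kappa>) w n)" for w n
        unfolding S_def by (simp add: sum.atLeast1_atMost_eq)
      show "MV_laplacian (\<lambda>m. \<i> * S M u m) n - \<i> * S M (MV_laplacian u) n =
        (\<Sum>p<M. of_real (\<rho> (Suc p * \<kappa>)) * MV_commutator (int (Suc p * \<kappa>)) u n)"
        unfolding MV_commutator_eq[symmetric]
        unfolding MV_laplacian_vector[of "\<lambda>m. \<i> * S M u m"] MV_laplacian_vector[of "\<lambda>m. \<i> * conj_op (Suc p * \<kappa>) u m" for p]
        unfolding S
        by (simp add: sum_distrib_left sum_divide_distrib sum_subtractf sum.distrib algebra_simps add_divide_distrib
            del: mult_Suc)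
    qed
    finally show ?thesis
      using C u by (simp add: sums_def is_commutator_ext_def)
  qed
  define F where "F = {n. u n \<noteq> 0}"
  have F: "finite F" "\<And>n. n \<notin> F \<Longrightarrow> u n = 0" using u by (auto simp: F_def fin_supp_def)
  have inner: "l2_inner u w = (\<Sum>n\<in>F. cnj (u n) * w n)" for w
    by (rule l2_inner_fin_supp) (use F in auto)
  have "(\<lambda>p. \<Sum>n\<in>F. cnj (u n) * (of_real (\<rho> (Suc p * \<kappa>)) * MV_commutator (int (Suc p * \<kappa>)) u n)) sums
      (\<Sum>n\<in>F. cnj (u n) * C u n)"
    by (intro sums_sum sums_mult pt)
  moreover have "(\<Sum>n\<in>F. cnj (u n) * (of_real (\<rho> (Suc p * \<kappa>)) * MV_commutator (int (Suc p * \<kappa>)) u n)) =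
      of_real (\<rho> (Suc p * \<kappa>)) * l2_inner u (MV_commutator (int (Suc p * \<kappa>)) u)" for p
    unfolding inner sum_distrib_left by (simp only: mult.left_commute)
  ultimately show ?thesis by (simp only: inner[of "C u"])
qed

section \<open>Mourre estimates and positivity on the energy surface\<close>

text \<open>
  Test the estimate with packets \<open>v\<close> at the angles of \<open>x\<close>. They are approximate eigenvectors of \<open>D\<close>
  for \<open>E\<close>, so \<open>P v\<close> may be replaced by \<open>v\<close> on both sides with a vanishing error; the left-hand side then
  tends to \<open>\<gamma>\<close> and \<open>\<langle>v, C v\<rangle>\<close> to the symbol at \<open>x\<close>, by dominated convergence for series.
\<close>
lemma mourre_symbol_positive:
  fixes A C :: "2 operator" and x :: "real ^ 2"
  assumes \<kappa>: "\<kappa> \<ge> 1" and A: "is_lin_comb \<kappa> \<rho> A" and C: "is_commutator_ext MV_laplacian A C"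
    and P: "spectral_resolution MV_laplacian P" and E: "a < E" "E < b"
    and mourre: "op_le (\<lambda>u n. of_real \<gamma> * P {a<..<b} u n) (P {a<..<b} \<circ> C \<circ> P {a<..<b})"
    and x: "x \<in> S_surface E"
  shows "\<gamma> \<le> (\<Sum>p. \<rho> (Suc p * \<kappa>) * g_fun (Suc p * \<kappa>) x)"
proof -
  define s t where "s = arccos (x $ 1)" and "t = arccos (x $ 2)"
  have st: "x $ 1 = cos s" "x $ 2 = cos t" "cos s * cos t = E"
    using x by (auto simp: s_def t_def S_surface_def UNIV_2)
  obtain v :: "nat \<Rightarrow> 2 lattice_fun" where v: "\<And>L. v L \<in> fin_supp" "\<And>L. l2_norm (v L) = 1"
    "\<And>a b. (\<lambda>L. l2_inner (v L) (\<lambda>n. v L (n + vector [a, b]))) \<longlonglongrightarrow> cis (of_int a * s + of_int b * t)"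
    using plane_wave_packets[of s t] by blast
  have l2: "v L \<in> l2" for L using v fin_supp_l2 by blast
  let ?P = "P {a<..<b}"
  interpret spec: spectral_op MV_laplacian P
    by (rule spectral_op.intro[OF bounded_op_MV_laplacian P])
  have Pl2: "?P u \<in> l2" if "u \<in> l2" for u using spec.spec_l2 that by simp
  have Cb: "bounded_op C" using C by (simp add: is_commutator_ext_def)
  note Cl2 = bounded_op_l2[OF Cb]
  obtain K0 where K0: "\<And>u. u \<in> l2 \<Longrightarrow> l2_norm (C u) \<le> K0 * l2_norm u"
    using Cb unfolding bounded_op_def by blast
  define K where "K = \<bar>K0\<bar>"
  have K: "l2_norm (C u) \<le> K * l2_norm u" if "u \<in> l2" for u
    using order_trans[OF K0[OF that] mult_right_mono[OF abs_ge_self l2_norm_ge_0]] by (simp add: K_def)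
  define r where "r L = (\<lambda>n. v L n - ?P (v L) n)" for L
  have r_l2: "r L \<in> l2" for L unfolding r_def by (intro l2_diff l2 Pl2)
  have r_bound: "l2_norm (r L) \<le> (1 / (E - a) + 1 / (b - E)) *
      l2_norm (\<lambda>n. MV_laplacian (v L) n - of_real E * v L n)" for L
    unfolding r_def by (rule spec.spec_localisation[OF l2 E])
  have r0: "(\<lambda>L. l2_norm (r L)) \<longlonglongrightarrow> 0"
  proof -
    have "(\<lambda>L. l2_norm (\<lambda>n. MV_laplacian (v L) n - of_real (cos s * cos t) * v L n)) \<longlonglongrightarrow> 0"
      by (rule packet_MV_eigen) (fact v)+
    then have lim: "(\<lambda>L. (1 / (E - a) + 1 / (b - E)) *
      l2_norm (\<lambda>n. MV_laplacian (v L) n - of_real E * v L n)) \<longlonglongrightarrow> 0"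
      unfolding st by (rule tendsto_mult_right_zero)
    show ?thesis
      by (rule Lim_null_comparison[OF always_eventually lim], rule allI) (simp add: r_bound)
  qed
  have Pv: "?P (v L) = (\<lambda>n. v L n - r L n)" for L by (simp add: r_def)
  have Pv_norm: "l2_norm (?P (v L)) \<le> 1 + l2_norm (r L)" for L
  proof -
    have "l2_norm (\<lambda>n. v L n + (-1) * r L n) \<le> l2_norm (v L) + l2_norm (\<lambda>n. (-1) * r L n)"
      by (intro l2_norm_triangle l2_scale l2 r_l2)
    then show ?thesis unfolding l2_norm_scale by (simp add: Pv v)
  qed
  \<comment> \<open>The last two terms bound the error of replacing \<open>P v = v - r\<close> by \<open>v\<close> in \<open>\<langle>P v, C P v\<rangle>\<close>.\<close>
  have main: "\<gamma> * (1 - Re (l2_inner (v L) (r L))) \<le> Re (l2_inner (v L) (C (v L))) +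
      (l2_norm (r L) * (K * (1 + l2_norm (r L))) + K * l2_norm (r L))" for L
  proof -
    have "Re (l2_inner (v L) (\<lambda>n. of_real \<gamma> * ?P (v L) n)) \<le> Re (l2_inner (v L) (?P (C (?P (v L)))))"
      using mourre l2 unfolding op_le_def by simp
    also have "l2_inner (v L) (?P (C (?P (v L)))) = l2_inner (?P (v L)) (C (?P (v L)))"
      by (rule spec.spec_symmetric[symmetric]) (use l2 Pl2 Cl2 in auto)
    also have "\<dots> = l2_inner (v L) (C (v L)) - (l2_inner (r L) (C (?P (v L))) + l2_inner (v L) (C (r L)))"
    proof -
      have "l2_inner (?P (v L)) (C (?P (v L))) = l2_inner (v L) (C (?P (v L))) - l2_inner (r L) (C (?P (v L)))"
        by (subst Pv) (rule l2_inner_diff_left, use l2 Pl2 Cl2 r_l2 in auto)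
      also have "l2_inner (v L) (C (?P (v L))) = l2_inner (v L) (C (v L)) - l2_inner (v L) (C (r L))"
        unfolding Pv bounded_op_diff[OF Cb l2 r_l2] by (rule l2_inner_diff_right, use l2 Pl2 Cl2 r_l2 in auto)
      finally show ?thesis by simp
    qed
    finally have 1: "\<gamma> * Re (l2_inner (v L) (?P (v L))) \<le> Re (l2_inner (v L) (C (v L))) -
        (Re (l2_inner (r L) (C (?P (v L)))) + Re (l2_inner (v L) (C (r L))))"
      by (simp add: l2_inner_scale_right)
    have 2: "Re (l2_inner (v L) (?P (v L))) = 1 - Re (l2_inner (v L) (r L))"
      unfolding Pv by (subst l2_inner_diff_right) (use l2 r_l2 v in \<open>auto simp: l2_inner_self\<close>)
    have "\<bar>Re (l2_inner (r L) (C (?P (v L))))\<bar> \<le> l2_norm (r L) * l2_norm (C (?P (v L)))"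
      by (rule order_trans[OF abs_Re_le_cmod l2_cauchy_schwarz]) (use l2 Pl2 Cl2 r_l2 in auto)
    also have "\<dots> \<le> l2_norm (r L) * (K * (1 + l2_norm (r L)))"
      by (intro mult_left_mono order_trans[OF K[OF Pl2[OF l2]]] Pv_norm) (auto simp: K_def)
    finally have 3: "\<bar>Re (l2_inner (r L) (C (?P (v L))))\<bar> \<le> l2_norm (r L) * (K * (1 + l2_norm (r L)))" .
    have "\<bar>Re (l2_inner (v L) (C (r L)))\<bar> \<le> l2_norm (v L) * l2_norm (C (r L))"
      by (rule order_trans[OF abs_Re_le_cmod l2_cauchy_schwarz]) (use l2 Pl2 Cl2 r_l2 in auto)
    also have "\<dots> \<le> K * l2_norm (r L)" using K[OF r_l2] by (simp add: v)
    finally have 4: "\<bar>Re (l2_inner (v L) (C (r L)))\<bar> \<le> K * l2_norm (r L)" .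
    show ?thesis using 1 3 4 unfolding 2 by linarith
  qed
  define G where "G = (\<Sum>p. \<rho> (Suc p * \<kappa>) * g_fun (Suc p * \<kappa>) x)"
  have lim_C: "(\<lambda>L. Re (l2_inner (v L) (C (v L)))) \<longlonglongrightarrow> G"
  proof -
    define c where "c p L = \<rho> (Suc p * \<kappa>) * Re (l2_inner (v L) (MV_commutator (int (Suc p * \<kappa>)) (v L)))" for p L
    have c_lim: "c p \<longlonglongrightarrow> \<rho> (Suc p * \<kappa>) * g_fun (Suc p * \<kappa>) x" for p
    proof -
      have "(\<lambda>L. l2_inner (v L) (MV_commutator (int (Suc p * \<kappa>)) (v L))) \<longlonglongrightarrow> of_real (g_fun (Suc p * \<kappa>) x)"
        by (rule packet_commutator_limit[OF v(1) v(3) st(1,2)]) (use \<kappa> in auto)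
      from tendsto_Re[OF this] show ?thesis unfolding c_def by (intro tendsto_mult tendsto_const) simp
    qed
    have c_bound: "norm (c p L) \<le> 2 * \<bar>\<rho> (Suc p * \<kappa>)\<bar>" for p L
    proof -
      have "\<bar>Re (l2_inner (v L) (MV_commutator (int (Suc p * \<kappa>)) (v L)))\<bar> \<le>
          l2_norm (v L) * l2_norm (MV_commutator (int (Suc p * \<kappa>)) (v L))"
        by (rule order_trans[OF abs_Re_le_cmod l2_cauchy_schwarz]) (use l2 MV_commutator_l2 in auto)
      also have "\<dots> \<le> 2" using MV_commutator_norm[OF l2] by (simp add: v)
      finally show ?thesis
        unfolding c_def real_norm_def abs_mult by (subst mult.commute[of 2]) (intro mult_left_mono abs_ge_zero)
    qed
    have "(\<lambda>L. \<Sum>p. c p L) \<longlonglongrightarrow> G"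
      unfolding G_def
    proof (rule tannerys_theorem[where M = "\<lambda>p. 2 * \<bar>\<rho> (Suc p * \<kappa>)\<bar>", THEN conjunct2, THEN conjunct2])
      show "summable (\<lambda>p. 2 * \<bar>\<rho> (Suc p * \<kappa>)\<bar>)"
        by (intro summable_mult lin_comb_coeffs_summable[OF A \<kappa>])
    qed (use c_lim c_bound in \<open>auto intro!: always_eventually\<close>)
    moreover have "(\<Sum>p. c p L) = Re (l2_inner (v L) (C (v L)))" for L
      using sums_Re[OF commutator_ext_sums[OF A C v(1)]] unfolding c_def
      by (simp add: sums_iff del: mult_Suc)
    ultimately show ?thesis by simp
  qed
  have lim_r: "(\<lambda>L. Re (l2_inner (v L) (r L))) \<longlonglongrightarrow> 0"
  proof (rule Lim_null_comparison[OF always_eventually r0], rule allI)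
    fix L
    have "\<bar>Re (l2_inner (v L) (r L))\<bar> \<le> l2_norm (v L) * l2_norm (r L)"
      by (rule order_trans[OF abs_Re_le_cmod l2_cauchy_schwarz]) (use l2 r_l2 in auto)
    then show "norm (Re (l2_inner (v L) (r L))) \<le> l2_norm (r L)" by (simp add: v)
  qed
  have "\<gamma> * (1 - 0) \<le> G + (0 * (K * (1 + 0)) + K * 0)"
  proof (rule LIMSEQ_le)
    show "(\<lambda>L. \<gamma> * (1 - Re (l2_inner (v L) (r L)))) \<longlonglongrightarrow> \<gamma> * (1 - 0)"
      by (intro tendsto_intros lim_r)
    show "(\<lambda>L. Re (l2_inner (v L) (C (v L))) +
      (l2_norm (r L) * (K * (1 + l2_norm (r L))) + K * l2_norm (r L))) \<longlonglongrightarrow> G + (0 * (K * (1 + 0)) + K * 0)"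
      by (intro tendsto_intros lim_C r0)
  qed (use main in auto)
  then show ?thesis by (simp add: G_def)
qed

lemma g_fun_bounded:
  assumes "x \<in> S_surface E" "k \<ge> 1"
  shows "\<bar>g_fun k (x :: real ^ 2)\<bar> \<le> 2"
proof -
  define s t where "s = arccos (x $ 1)" and "t = arccos (x $ 2)"
  have st: "x $ 1 = cos s" "x $ 2 = cos t"
    using assms by (auto simp: s_def t_def S_surface_def)
  have "\<bar>cos a * (sin b * sin c)\<bar> \<le> 1 * (1 * 1)" for a b c :: real
    unfolding abs_mult by (intro mult_mono) auto
  from this[of t s "real k * s"] this[of s t "real k * t"] show ?thesis
    unfolding g_fun_cos[OF st assms(2)] by linarith
qed

text \<open>
  Summing the relation \<open>g(x\<^sub>m) = \<Sum> \<omega>\<^sub>q g(x\<^sub>q)\<close> with the weights \<open>\<rho>\<close> shows that the symbol of a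
  commutator cannot be positive at all the points \<open>x\<^sub>0, \<dots>, x\<^sub>m\<close> of \<open>S\<^sub>E\<close>.
\<close>
lemma Theta_m_subset_Theta:
  assumes \<kappa>: "\<kappa> \<ge> 1" shows "Theta_m_set TYPE(2) m \<kappa> \<subseteq> Theta_set TYPE(2) \<kappa>"
proof
  fix E assume "E \<in> Theta_m_set TYPE(2) m \<kappa>"
  then obtain x :: "nat \<Rightarrow> real ^ 2" and \<omega> where E: "E \<in> {-1..1}"
    and x: "\<And>q. q \<le> m \<Longrightarrow> x q \<in> S_surface E" and \<omega>: "\<And>q. q < m \<Longrightarrow> \<omega> q \<le> 0"
    and rel: "\<And>p. p \<ge> 1 \<Longrightarrow> g_fun (p * \<kappa>) (x m) = (\<Sum>q<m. \<omega> q * g_fun (p * \<kappa>) (x q))"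
    unfolding Theta_m_set_def by blast
  have "E \<notin> mu_set TYPE(2) \<kappa>"
  proof
    assume "E \<in> mu_set TYPE(2) \<kappa>"
    then obtain \<rho> and A C :: "2 operator" and P a b \<gamma> where A: "is_lin_comb \<kappa> \<rho> A"
      and *: "is_commutator_ext MV_laplacian A C" "spectral_resolution MV_laplacian P" "a < E" "E < b"
       "op_le (\<lambda>u n. of_real \<gamma> * P {a<..<b} u n) (P {a<..<b} \<circ> C \<circ> P {a<..<b})" and \<gamma>: "\<gamma> > 0"
      unfolding mu_set_def by blast
    define G where "G y = (\<Sum>p. \<rho> (Suc p * \<kappa>) * g_fun (Suc p * \<kappa>) y)" for y :: "real ^ 2"
    have pos: "G (x q) > 0" if "q \<le> m" for q
      using mourre_symbol_positive[OF \<kappa> A * x[OF that]] \<gamma> by (simp add: G_def)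
    have summ: "summable (\<lambda>p. \<rho> (Suc p * \<kappa>) * g_fun (Suc p * \<kappa>) (x q))" if "q \<le> m" for q
    proof (rule summable_comparison_test'[where N = 0])
      show "summable (\<lambda>p. \<bar>\<rho> (Suc p * \<kappa>)\<bar> * 2)"
        by (intro summable_mult2 lin_comb_coeffs_summable[OF A \<kappa>])
      fix p
      have "\<bar>g_fun (Suc p * \<kappa>) (x q)\<bar> \<le> 2" by (rule g_fun_bounded[OF x[OF that]]) (use \<kappa> in auto)
      then show "norm (\<rho> (Suc p * \<kappa>) * g_fun (Suc p * \<kappa>) (x q)) \<le> \<bar>\<rho> (Suc p * \<kappa>)\<bar> * 2"
        by (simp add: abs_mult mult_left_mono del: mult_Suc)
    qed
    have "(\<lambda>p. \<Sum>q<m. \<omega> q * (\<rho> (Suc p * \<kappa>) * g_fun (Suc p * \<kappa>) (x q))) sums (\<Sum>q<m. \<omega> q * G (x q))"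
      unfolding G_def by (intro sums_sum sums_mult summable_sums summ) auto
    moreover have "(\<Sum>q<m. \<omega> q * (\<rho> (Suc p * \<kappa>) * g_fun (Suc p * \<kappa>) (x q))) =
        \<rho> (Suc p * \<kappa>) * g_fun (Suc p * \<kappa>) (x m)" for p
      by (subst rel) (simp_all add: sum_distrib_left mult.left_commute del: mult_Suc)
    ultimately have "G (x m) = (\<Sum>q<m. \<omega> q * G (x q))"
      unfolding G_def by (simp add: sums_iff del: mult_Suc)
    also have "\<dots> \<le> 0"
      using pos by (intro sum_nonpos mult_nonpos_nonneg \<omega>) (auto intro: less_imp_le)
    finally show False using pos[of m] by simp
  qed
  then show "E \<in> Theta_set TYPE(2) \<kappa>"
    using MV_spectrum[OF E] by (simp add: Theta_set_def)
qed

section \<open>Reflected chains\<close>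

text \<open>
  The orbit of \<open>a\<close> under \<open>x \<mapsto> E / R x\<close>, without \<open>a\<close> itself; its first point is \<open>E / R a = E / c\<close>.
\<close>
primrec refl_iter :: "(real \<Rightarrow> real) \<Rightarrow> real \<Rightarrow> real \<Rightarrow> nat \<Rightarrow> real" where
  "refl_iter R c E 0 = E / c"
| "refl_iter R c E (Suc q) = E / R (refl_iter R c E q)"

text \<open>
  Besides \<open>\<Sigma>\<^sub>n\<close> in terms of the reflection \<open>R\<close>, this records the ordering, the position of the
  lower half relative to \<open>b\<close>, and, for even \<open>n\<close>, the normalisation \<open>b\<close> of the middle entry, which
  \<open>\<Sigma>\<^sub>n\<close> leaves free.
\<close>
definition reflected_chain ::
    "(real \<Rightarrow> real) \<Rightarrow> real \<Rightarrow> real \<Rightarrow> real \<Rightarrow> nat \<Rightarrow> real \<Rightarrow> (nat \<Rightarrow> real) \<Rightarrow> bool" where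
  "reflected_chain R a b c n E X \<longleftrightarrow>
     X 0 = E / c \<and> X (n + 1) = c \<and> (\<forall>q\<le>n. X q < X (q + 1)) \<and>
     (\<forall>r\<le>n + 1. X (n + 1 - r) = E / X r) \<and>
     (\<forall>q<(n + 1) div 2. a < X q \<and> X q < b \<and> X (n - q) = R (X q)) \<and>
     (even n \<longrightarrow> X (n div 2) = b)"

text \<open>
  A decreasing reflection of \<open>[a, b]\<close> onto \<open>[b, c]\<close>, extended to a continuous antitone map of the
  real line. The extension makes every iterate a continuous function of the energy, so that no
  domain conditions enter the intermediate value arguments. The inequality \<open>a c < b\<^sup>2\<close> keeps the
  orbit to the right of \<open>a\<close> for energies from \<open>b\<^sup>2\<close> on.
\<close>
locale reflection =
  fixes a b c :: real and R :: "real \<Rightarrow> real"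
  assumes b0: "0 < b" and ab: "a < b" and bc: "b < c" and ac: "a * c < b\<^sup>2"
    and R_cont: "continuous_on UNIV R"
    and R_ge: "\<And>x. b \<le> R x"
    and R_anti: "\<And>x y. x \<le> y \<Longrightarrow> R y \<le> R x"
    and R_strict: "\<And>x y. a \<le> x \<Longrightarrow> x < y \<Longrightarrow> y \<le> b \<Longrightarrow> R y < R x"
    and Ra: "R a = c" and Rb: "R b = b"
begin

abbreviation "it \<equiv> refl_iter R c"

lemma R_pos: "0 < R x" using R_ge[of x] b0 by linarith

lemma c0: "0 < c" using b0 bc by linarith

lemma refl_iter_pos: "0 < E \<Longrightarrow> 0 < it E q"
  using R_pos c0 by (cases q) auto

lemma refl_iter_strict_mono:
  assumes "0 < E" "E < E'" shows "it E q < it E' q"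
proof (induction q)
  case 0
  then show ?case using assms c0 by (simp add: divide_strict_right_mono)
next
  case (Suc q)
  have "E / R (it E q) \<le> E / R (it E' q)"
    using R_anti[of "it E q" "it E' q"] Suc R_pos assms by (intro divide_left_mono) auto
  also have "\<dots> < E' / R (it E' q)"
    using assms R_pos by (intro divide_strict_right_mono) auto
  finally show ?case by simp
qed

lemma refl_iter_cont: "continuous_on UNIV (\<lambda>E. it E q)"
proof (induction q)
  case (Suc q)
  have "continuous_on UNIV (\<lambda>E. R (it E q))"
    by (rule continuous_on_compose2[OF R_cont Suc]) auto
  then show ?case using R_pos by (auto intro!: continuous_intros simp: less_imp_neq[symmetric])
qed (use c0 in \<open>auto intro!: continuous_intros\<close>)

lemma refl_iter_0_gt_a: "b\<^sup>2 \<le> E \<Longrightarrow> a < E / c"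
  using ac c0 by (simp add: field_simps)

lemma refl_iter_mono:
  assumes "b\<^sup>2 \<le> E" shows "it E q \<le> it E (Suc q)"
proof (induction q)
  have E: "0 < E" using assms b0 by (smt (verit) zero_less_power)
  case 0
  have "R (E / c) \<le> c" using R_anti[of a "E / c"] refl_iter_0_gt_a[OF assms] Ra by simp
  then have "E / c \<le> E / R (E / c)"
    using E R_pos c0 by (intro divide_left_mono mult_pos_pos) auto
  then show ?case by simp
next
  have E: "0 < E" using assms b0 by (smt (verit) zero_less_power)
  case (Suc q)
  have "E / R (it E q) \<le> E / R (it E (Suc q))"
    using R_anti[OF Suc] R_pos E by (intro divide_left_mono mult_pos_pos) auto
  then show ?case by simp
qed

lemma refl_iter_mono_le:
  "b\<^sup>2 \<le> E \<Longrightarrow> q \<le> r \<Longrightarrow> it E q \<le> it E r"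
  by (rule lift_Suc_mono_le[of "it E", OF refl_iter_mono])

lemma refl_iter_gt_a: "b\<^sup>2 \<le> E \<Longrightarrow> a < it E q"
  using refl_iter_0_gt_a refl_iter_mono_le[of E 0 q] by fastforce

text \<open>
  At the energy \<open>b\<^sup>2\<close> the point \<open>b\<close> is fixed by the increasing map \<open>x \<mapsto> b\<^sup>2 / R x\<close>, and an orbit that
  starts below it stays below.
\<close>
lemma refl_iter_below: "it (b\<^sup>2) q < b"
proof (induction q)
  case 0
  then show ?case using b0 bc c0 by (simp add: field_simps power2_eq_square)
next
  case (Suc q)
  have "b < R (it (b\<^sup>2) q)"
    using R_strict[OF less_imp_le[OF refl_iter_gt_a] Suc] Rb by simp
  then show ?case using b0 R_pos[of "it (b\<^sup>2) q"] by (simp add: field_simps power2_eq_square)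
qed

lemma refl_iter_strict:
  assumes E: "b\<^sup>2 < E" and q: "it E q \<le> b" shows "it E q < it E (Suc q)"
  using q
proof (induction q)
  have E0: "0 < E" using E b0 by (smt (verit) zero_less_power)
  case 0
  have "R (E / c) < R a"
    using refl_iter_0_gt_a[of E] E 0 by (intro R_strict) auto
  then show ?case using E0 R_pos[of "E / c"] c0 Ra by (simp add: divide_strict_left_mono)
next
  have E0: "0 < E" using E b0 by (smt (verit) zero_less_power)
  case (Suc q)
  have "it E q \<le> b" using refl_iter_mono[of E q] E Suc.prems by linarith
  then have "it E q < it E (Suc q)" by (rule Suc.IH)
  then have "R (it E (Suc q)) < R (it E q)"
    using Suc.prems refl_iter_gt_a[of E q] E by (intro R_strict) auto
  then have "E / R (it E q) < E / R (it E (Suc q))"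
    using E0 R_pos by (intro divide_strict_left_mono) auto
  then show ?case by simp
qed

text \<open>
  The energy of the chain with \<open>n = 2 m\<close>, by the intermediate value theorem between \<open>b\<^sup>2\<close> and \<open>b c\<close>;
  at \<open>b c\<close> the orbit starts at \<open>b\<close>.
\<close>
lemma even_energy_exists: "\<exists>E. b\<^sup>2 < E \<and> E \<le> b * c \<and> it E m = b"
proof -
  have le: "b\<^sup>2 \<le> b * c" using b0 bc by (simp add: power2_eq_square)
  have "b = it (b * c) 0" using c0 by simp
  also have "\<dots> \<le> it (b * c) m" using le by (intro refl_iter_mono_le) auto
  finally have "\<exists>E\<ge>b\<^sup>2. E \<le> b * c \<and> it E m = b"
    using refl_iter_below[of m] le
    by (intro IVT') (auto intro: continuous_on_subset[OF refl_iter_cont])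
  then obtain E where E: "b\<^sup>2 \<le> E" "E \<le> b * c" "it E m = b" by blast
  moreover have "E \<noteq> b\<^sup>2" using refl_iter_below[of m] E by auto
  ultimately show ?thesis by force
qed

text \<open>
  Here \<open>E\<close> and \<open>E'\<close> are the energies for \<open>n = 2 m\<close> and \<open>n = 2 m + 2\<close>. At \<open>E\<close> the iterate with index
  \<open>m + 1\<close> is \<open>E / b\<close>, which exceeds both \<open>b\<close> and \<open>\<surd>E\<close>; at \<open>E'\<close> it is \<open>b\<close>, which is less than
  \<open>\<surd>E'\<close>. So \<open>E' < E\<close>, and the energy for \<open>n = 2 m + 1\<close> lies in between.
\<close>
lemma odd_energy_exists:
  assumes E: "b\<^sup>2 < E" "it E m = b" and E': "b\<^sup>2 < E'" "it E' (Suc m) = b"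
  shows "E' < E" and "\<exists>F. E' < F \<and> F < E \<and> it F (Suc m) = sqrt F"
proof -
  have pos: "0 < E" "0 < E'" using E E' b0 by (smt (verit) zero_less_power)+
  have at_E: "it E (Suc m) = E / b" using E Rb by simp
  have "b < E / b" using E b0 by (simp add: field_simps power2_eq_square)
  then have lt: "it E' (Suc m) < it E (Suc m)" using E' at_E by (simp del: refl_iter.simps)
  show "E' < E"
  proof (rule ccontr)
    assume "\<not> E' < E"
    then show False using lt refl_iter_strict_mono[OF pos(1), of E' "Suc m"] by (cases "E = E'") auto
  qed
  define h where "h F = it F (Suc m) - sqrt F" for F
  have "h E' < 0"
    unfolding h_def E' using real_less_rsqrt[OF E'(1)] by simp
  moreover have "0 < h E"
  proof -
    have "sqrt E * b < sqrt E * sqrt E"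
      by (rule mult_strict_left_mono[OF real_less_rsqrt[OF E(1)]]) (simp add: pos)
    then show ?thesis unfolding h_def at_E using pos b0 by (simp add: field_simps)
  qed
  moreover have "continuous_on {E'..E} h"
    unfolding h_def by (intro continuous_intros continuous_on_subset[OF refl_iter_cont]) auto
  ultimately obtain F where F: "E' \<le> F" "F \<le> E" "h F = 0"
    using IVT'[of h E' 0 E] \<open>E' < E\<close> by auto
  moreover have "F \<noteq> E" "F \<noteq> E'" using F \<open>h E' < 0\<close> \<open>0 < h E\<close> by auto
  ultimately show "\<exists>F. E' < F \<and> F < E \<and> it F (Suc m) = sqrt F"
    by (intro exI[of _ F]) (auto simp: h_def)
qed

text \<open>
  The lower half of the chain is the orbit, the upper half is its image under \<open>x \<mapsto> E / x\<close>. The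
  condition in the middle makes the two descriptions agree.
\<close>
lemma reflected_chainI:
  assumes E: "b\<^sup>2 < E" and m: "1 \<le> m" and below: "it E (m - 1) < b"
    and n: "n = 2 * m - 1 \<and> it E m = sqrt E \<or> n = 2 * m \<and> it E m = b"
  shows "\<exists>X. reflected_chain R a b c n E X"
proof -
  have E0: "0 < E" using E b0 by (smt (verit) zero_less_power)
  define X where "X r = (if r \<le> m then it E r else E / it E (n + 1 - r))" for r
  have itpos: "0 < it E r" for r using E0 by (rule refl_iter_pos)
  have sym: "X (n + 1 - r) = E / X r" if r: "r \<le> n + 1" for r
  proof (cases "r \<le> m")
    case True
    show ?thesis
    proof (cases "n + 1 - r \<le> m")
      case le: True
      then have "n = 2 * m - 1" "r = m" "n + 1 - r = m" using True n m r by auto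
      moreover from this have "it E m = sqrt E" using n m by auto
      ultimately show ?thesis using E0 by (simp add: X_def real_div_sqrt)
    next
      case False
      then show ?thesis using True r by (simp add: X_def)
    qed
  next
    case False
    then have "n + 1 - r \<le> m" using n by auto
    then show ?thesis using False itpos[of "n + 1 - r"] E0 by (simp add: X_def)
  qed
  have low: "it E q < b" if "q < m" for q
  proof -
    have "q \<le> m - 1" using that by simp
    from refl_iter_mono_le[OF less_imp_le[OF E] this] below show ?thesis by linarith
  qed
  have Xpos: "0 < X r" for r using itpos E0 by (simp add: X_def)
  have inc_low: "X q < X (q + 1)" if "q < m" for q
    using refl_iter_strict[OF E less_imp_le[OF low[OF that]]] that
    by (simp add: X_def del: refl_iter.simps)
  have inc: "X q < X (q + 1)" if "q \<le> n" for q
  proof (cases "q < m")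
    case False
    have "E / X (n + 1 - q) < E / X (n - q)"
    proof (cases "n - q < m")
      case True
      have "n - q + 1 = n + 1 - q" using that by simp
      then have "X (n - q) < X (n + 1 - q)" using inc_low[OF True] by simp
      then show ?thesis using Xpos E0 by (intro divide_strict_left_mono) auto
    next
      case c: False
      then have q: "q = m" "n = 2 * m" "it E m = b" using n False m by auto
      have "E / X (n + 1 - q) = b" using sym[of "m"] sym[of "n + 1 - m"] q by (simp add: X_def)
      moreover have "X (n - q) = b" using q by (simp add: X_def)
      moreover have "b < E / b" using E b0 by (simp add: field_simps power2_eq_square)
      ultimately show ?thesis by simp
    qed
    moreover have "X q = E / X (n + 1 - q)" using sym[of "n + 1 - q"] that by simp
    moreover have "X (q + 1) = E / X (n - q)" using sym[of "n - q"] that by (simp add: Suc_diff_le)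
    ultimately show ?thesis by simp
  qed (use inc_low in blast)
  have X0: "X 0 = E / c" by (simp add: X_def)
  have "X (n + 1) = c" using sym[of 0] X0 E0 c0 by simp
  moreover have "a < X q \<and> X q < b \<and> X (n - q) = R (X q)" if "q < (n + 1) div 2" for q
  proof -
    have q: "q < m" "q \<le> n" using that n by auto
    have "X (n - q) = E / X (q + 1)" using sym[of "q + 1"] q by simp
    also have "\<dots> = R (X q)" using q E0 R_pos[of "it E q"] by (simp add: X_def)
    finally show ?thesis using low[OF q(1)] refl_iter_gt_a[of E q] E q by (simp add: X_def)
  qed
  moreover have "X (n div 2) = b" if "even n" using n m that by (auto simp: X_def)
  ultimately have "reflected_chain R a b c n E X"
    unfolding reflected_chain_def using X0 inc sym by blast
  then show ?thesis by blast
qed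

text \<open>
  The energies of even and odd index are found independently of each other; only the interlacing
  of \<open>odd_energy_exists\<close> puts them in order. For even index, the strict bound by \<open>b c\<close> comes from
  comparison with the energy found for \<open>m = 0\<close>.
\<close>
lemma reflected_chains_exist:
  "\<exists>\<E>. \<forall>n\<ge>1. b\<^sup>2 < \<E> n \<and> \<E> n < b * c \<and> \<E> (n + 1) < \<E> n \<and> (\<exists>X. reflected_chain R a b c n (\<E> n) X)"
proof -
  obtain e where e: "\<And>m. b\<^sup>2 < e m" "\<And>m. e m \<le> b * c" "\<And>m. it (e m) m = b"
    using even_energy_exists by metis
  have dec: "e (Suc m) < e m" for m
    by (rule odd_energy_exists(1)[OF e(1) e(3) e(1) e(3)])
  have "\<exists>F. e (Suc m) < F \<and> F < e m \<and> it F (Suc m) = sqrt F" for m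
    by (rule odd_energy_exists(2)[OF e(1) e(3) e(1) e(3)])
  then obtain f where f: "\<And>m. e (Suc m) < f m" "\<And>m. f m < e m" "\<And>m. it (f m) (Suc m) = sqrt (f m)"
    by metis
  define \<E> where "\<E> n = (if even n then e (n div 2) else f (n div 2))" for n
  have "b\<^sup>2 < \<E> n \<and> \<E> n < b * c \<and> \<E> (n + 1) < \<E> n \<and> (\<exists>X. reflected_chain R a b c n (\<E> n) X)"
    if n: "n \<ge> 1" for n
  proof (cases "even n")
    case True
    then obtain m where m: "n = 2 * Suc m" using n by (metis evenE mult_0_right not0_implies_Suc not_one_le_zero)
    have en: "\<E> n = e (Suc m)" "\<E> (n + 1) = f (Suc m)" using m by (auto simp: \<E>_def)
    have "it (e (Suc m)) m < it (e m) m"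
      using dec e(1) b0 by (intro refl_iter_strict_mono) (smt (verit) zero_less_power)+
    then have "\<exists>X. reflected_chain R a b c n (e (Suc m)) X"
      using e m by (intro reflected_chainI[where m = "Suc m"]) (auto simp del: refl_iter.simps)
    then show ?thesis unfolding en using e(1) f(2) order_less_le_trans[OF dec e(2)] by simp
  next
    case False
    then obtain m where m: "n = 2 * m + 1" by (rule oddE)
    have en: "\<E> n = f m" "\<E> (n + 1) = e (Suc m)" using m by (auto simp: \<E>_def)
    have E: "b\<^sup>2 < f m" using e(1) f(1) less_trans by blast
    have "it (f m) m < it (e m) m"
      using f(2) E b0 by (intro refl_iter_strict_mono) (smt (verit) zero_less_power)+
    then have "\<exists>X. reflected_chain R a b c n (f m) X"
      using e m E f(3)[of m] by (intro reflected_chainI[where m = "Suc m"]) (auto simp del: refl_iter.simps)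
    then show ?thesis unfolding en using E f(1) order_less_le_trans[OF f(2) e(2)] by simp
  qed
  then show ?thesis by blast
qed

end


section \<open>Linear relations along a chain\<close>

text \<open>
  Solve \<open>g\<^sub>r = Y\<^sub>r \<phi>\<^sub>r + X\<^sub>r \<psi>\<^sub>r\<close> for \<open>\<phi>\<^sub>r\<close>: the link replaces \<open>-\<psi>\<^sub>r\<close> by a nonnegative
  multiple of \<open>\<phi>\<^bsub>r-1\<^esub>\<close>, to which the induction hypothesis applies. The coefficients are the same
  for all \<open>p\<close>.
\<close>
lemma alternating_chain_combination:
  fixes X Y l :: "nat \<Rightarrow> real" and \<phi> \<psi> :: "nat \<Rightarrow> nat \<Rightarrow> real"
  assumes pos: "\<And>r. r \<le> m \<Longrightarrow> 0 < X r" "\<And>r. r \<le> m \<Longrightarrow> 0 < Y r"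
    and start: "\<And>p. \<psi> p 0 = 0"
    and link: "\<And>p r. r < m \<Longrightarrow> \<psi> p (Suc r) = - l r * \<phi> p r"
    and l: "\<And>r. r < m \<Longrightarrow> 0 \<le> l r"
    and r: "r \<le> m"
  shows "\<exists>\<alpha>. (\<forall>q. 0 \<le> \<alpha> q) \<and> (\<forall>p. \<phi> p r = (\<Sum>q\<le>r. \<alpha> q * (Y q * \<phi> p q + X q * \<psi> p q)))"
  using r
proof (induction r)
  case 0
  show ?case
    using pos(2)[of 0] by (intro exI[of _ "\<lambda>q. 1 / Y 0"]) (simp add: start)
next
  case (Suc r)
  then obtain \<alpha> where \<alpha>: "\<And>q. 0 \<le> \<alpha> q"
    "\<And>p. \<phi> p r = (\<Sum>q\<le>r. \<alpha> q * (Y q * \<phi> p q + X q * \<psi> p q))" by auto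
  \<comment> \<open>\<open>\<phi>\<close> at \<open>Suc r\<close> equals \<open>g / Y (Suc r)\<close> plus \<open>k\<close> times \<open>\<phi>\<close> at \<open>r\<close>.\<close>
  define k where "k = X (Suc r) * l r / Y (Suc r)"
  define \<beta> where "\<beta> q = (if q = Suc r then 1 / Y (Suc r) else k * \<alpha> q)" for q
  have k: "0 \<le> k"
    unfolding k_def using pos[OF Suc.prems] l[of r] Suc.prems by simp
  have "\<phi> p (Suc r) = (\<Sum>q\<le>Suc r. \<beta> q * (Y q * \<phi> p q + X q * \<psi> p q))" for p
  proof -
    have "(\<Sum>q\<le>r. \<beta> q * (Y q * \<phi> p q + X q * \<psi> p q)) = k * \<phi> p r"
      unfolding \<alpha>(2)[of p] sum_distrib_left by (intro sum.cong) (auto simp: \<beta>_def)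
    then show ?thesis
      using pos(2)[OF Suc.prems] link[of r p] Suc.prems by (simp add: \<beta>_def k_def field_simps)
  qed
  moreover have "\<forall>q. 0 \<le> \<beta> q"
    using k \<alpha>(1) pos(2)[OF Suc.prems] by (simp add: \<beta>_def)
  ultimately show ?case by blast
qed

text \<open>
  The points of the relation are the pairs \<open>(X\<^sub>q, X\<^bsub>n+1-q\<^esub>)\<close>, \<open>q \<le> m\<close>, whose product is \<open>E\<close>. The
  first pair contains \<open>c\<close>, where \<open>\<phi>\<close> vanishes; this starts \<open>alternating_chain_combination\<close>. At the
  last pair either both entries coincide (odd \<open>n\<close>) or one of them is the zero \<open>b\<close> of \<open>\<phi>\<close>
  (even \<open>n\<close>), so that \<open>g\<close> is a positive multiple of \<open>\<phi>(X\<^bsub>n+1-m\<^esub>)\<close> and hence a nonpositive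
  multiple of \<open>\<phi>(X\<^bsub>m-1\<^esub>)\<close>.
\<close>
lemma Theta_mI:
  fixes X :: "nat \<Rightarrow> real"
  assumes n: "n \<ge> 1" and m: "m = (n + 1) div 2" and c: "c \<le> 1" and E: "0 < E"
    and chain: "reflected_chain R a b c n E X" and c0: "c > 0"
    and zero: "\<And>p. p \<ge> 1 \<Longrightarrow> cheb_sin (p * \<kappa>) c = 0" "\<And>p. p \<ge> 1 \<Longrightarrow> cheb_sin (p * \<kappa>) b = 0"
    and refl: "\<And>x. a < x \<Longrightarrow> x < b \<Longrightarrow>
       \<exists>l\<ge>0. \<forall>p\<ge>1. cheb_sin (p * \<kappa>) (R x) = - l * cheb_sin (p * \<kappa>) x"
  shows "E \<in> Theta_m_set TYPE(2) m \<kappa>"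
proof -
  note ch = chain[unfolded reflected_chain_def]
  have X0: "X 0 = E / c" and Xn: "X (n + 1) = c"
    and inc: "\<And>q. q \<le> n \<Longrightarrow> X q < X (q + 1)"
    and sym: "\<And>r. r \<le> n + 1 \<Longrightarrow> X (n + 1 - r) = E / X r"
    and low: "\<And>q. q < m \<Longrightarrow> a < X q \<and> X q < b \<and> X (n - q) = R (X q)"
    and mid: "even n \<Longrightarrow> X (n div 2) = b"
    using ch unfolding m by auto
  have "X 0 \<le> X r" if "r \<le> n + 1" for r
    using that
  proof (induction r)
    case (Suc r) then show ?case using inc[of r] by simp
  qed simp
  then have Xpos: "0 < X r" if "r \<le> n + 1" for r
    using that X0 E c0 by (smt (verit) divide_pos_pos)
  have Xle: "X r \<le> c" if "r \<le> n + 1" for r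
    using that
  proof (induction r rule: inc_induct)
    case (step r) then show ?case using inc[of r] by simp
  qed (simp add: Xn[simplified])
  define x where "x q = (vector [X q, X (n + 1 - q)] :: real ^ 2)" for q
  have mn: "m \<le> n" "1 \<le> m" using n m by auto
  have prod_E: "X q * X (n + 1 - q) = E" if "q \<le> n + 1" for q
    using sym[OF that] Xpos[OF that] by simp
  have x: "x q \<in> S_surface E" if "q \<le> m" for q
  proof -
    have "q \<le> n + 1" "n + 1 - q \<le> n + 1" using that mn by auto
    then show ?thesis
      using Xpos[of q] Xle[of q] Xpos[of "n + 1 - q"] Xle[of "n + 1 - q"] prod_E[of q] c
      by (auto simp: S_surface_def x_def forall_2 UNIV_2)
  qed
  have "\<forall>q<m. \<exists>l\<ge>0. \<forall>p\<ge>1. cheb_sin (p * \<kappa>) (X (n - q)) = - l * cheb_sin (p * \<kappa>) (X q)"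
    using low refl by simp
  then obtain l where l: "\<And>q. q < m \<Longrightarrow> 0 \<le> l q"
    "\<And>q p. q < m \<Longrightarrow> p \<ge> 1 \<Longrightarrow> cheb_sin (p * \<kappa>) (X (n - q)) = - l q * cheb_sin (p * \<kappa>) (X q)"
    by metis
  \<comment> \<open>The index is \<open>Suc p\<close> since \<open>cheb_sin 0\<close> is not the zero function.\<close>
  define \<phi> where "\<phi> p r = cheb_sin (Suc p * \<kappa>) (X r)" for p r
  define \<psi> where "\<psi> p r = cheb_sin (Suc p * \<kappa>) (X (n + 1 - r))" for p r
  have g: "g_fun (Suc p * \<kappa>) (x q) = X (n + 1 - q) * \<phi> p q + X q * \<psi> p q" for p q
    unfolding x_def g_fun_cheb_sin vector_2 \<phi>_def \<psi>_def ..
  have link: "\<psi> p (Suc r) = - l r * \<phi> p r" if "r < m" for p r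
    using l(2)[OF that, of "Suc p"] by (simp add: \<psi>_def \<phi>_def del: mult_Suc)
  have "\<exists>\<alpha>. (\<forall>q. 0 \<le> \<alpha> q) \<and>
     (\<forall>p. \<phi> p (m - 1) = (\<Sum>q\<le>m - 1. \<alpha> q * (X (n + 1 - q) * \<phi> p q + X q * \<psi> p q)))"
  proof (rule alternating_chain_combination[where l = l and m = "m - 1"])
    show "\<psi> p 0 = 0" for p using zero(1)[of "Suc p"] Xn by (simp add: \<psi>_def del: mult_Suc)
  qed (use Xpos l(1) link mn in auto)
  then obtain \<alpha> where \<alpha>: "\<And>q. 0 \<le> \<alpha> q"
    "\<And>p. \<phi> p (m - 1) = (\<Sum>q\<le>m - 1. \<alpha> q * g_fun (Suc p * \<kappa>) (x q))"
    unfolding g by auto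
  obtain d where d: "0 \<le> d" "\<And>p. g_fun (Suc p * \<kappa>) (x m) = d * \<psi> p m"
  proof (cases "even n")
    case True
    then have "m = n div 2" using m by auto
    then have "\<phi> p m = 0" for p
      using zero(2)[of "Suc p"] mid[OF True] by (simp add: \<phi>_def del: mult_Suc)
    then show ?thesis using that[of "X m"] Xpos[of m] mn by (simp add: g del: mult_Suc)
  next
    case False
    then have "n + 1 - m = m" using m by (auto elim!: oddE)
    then have "\<phi> p m = \<psi> p m" "X (n + 1 - m) = X m" for p by (simp_all add: \<phi>_def \<psi>_def)
    then show ?thesis using that[of "2 * X m"] Xpos[of m] mn by (simp add: g del: mult_Suc)
  qed
  define \<omega> where "\<omega> q = - (d * l (m - 1) * \<alpha> q)" for q
  have \<omega>: "\<omega> q \<le> 0" for q using d(1) l(1)[of "m - 1"] \<alpha>(1) mn by (simp add: \<omega>_def)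
  have rel: "g_fun (Suc p * \<kappa>) (x m) = (\<Sum>q<m. \<omega> q * g_fun (Suc p * \<kappa>) (x q))" for p
  proof -
    have "g_fun (Suc p * \<kappa>) (x m) = - (d * l (m - 1)) * \<phi> p (m - 1)"
      using link[of "m - 1" p] mn by (simp add: d(2) del: mult_Suc)
    also have "\<dots> = (\<Sum>q\<le>m - 1. \<omega> q * g_fun (Suc p * \<kappa>) (x q))"
      unfolding \<alpha>(2) sum_distrib_left by (simp add: \<omega>_def mult.assoc del: mult_Suc)
    also have "{..m - 1} = {..<m}" using mn by auto
    finally show ?thesis .
  qed
  have rel': "g_fun (p * \<kappa>) (x m) = (\<Sum>q<m. \<omega> q * g_fun (p * \<kappa>) (x q))" if "p \<ge> 1" for p
    using rel[of "p - 1"] that by simp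
  have "E = X 0 * X (n + 1)" using prod_E[of 0] by simp
  also have "\<dots> \<le> 1 * 1"
    using Xpos[of 0] Xpos[of "n + 1"] Xle[of 0] Xle[of "n + 1"] c by (intro mult_mono) auto
  finally have "E \<in> {-1..1}" using E by simp
  then show ?thesis
    unfolding Theta_m_set_def using x \<omega> rel' by blast
qed

lemma Sigma_systemI:
  assumes chain: "reflected_chain R a b c n E X" and n: "n \<ge> 1" and E: "E > 0" and c: "c > 0"
    and T: "\<And>x. a < x \<Longrightarrow> x < b \<Longrightarrow> poly (cheb_T \<kappa>) (R x) = poly (cheb_T \<kappa>) x"
  shows "Sigma_system \<kappa> n E X"
proof -
  note ch = chain[unfolded reflected_chain_def]
  have sym: "\<And>r. r \<le> n + 1 \<Longrightarrow> X (n + 1 - r) = E / X r" using ch by blast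
  have *: "poly (cheb_T \<kappa>) (X q) = poly (cheb_T \<kappa>) (X (n - q)) \<and> X (n - q) = E / X (1 + q)"
    if q: "q < (n + 1) div 2" for q
  proof -
    have "a < X q" "X q < b" "X (n - q) = R (X q)" using ch q by blast+
    moreover have "X (n - q) = E / X (1 + q)" using sym[of "1 + q"] q by simp
    ultimately show ?thesis using T[of "X q"] by simp
  qed
  have "X (n + 1) = E / X 0" using sym[of 0] by simp
  moreover have "q < (n + 1) div 2" if "odd n" "q \<le> (n - 1) div 2" for q
    using that by (auto elim!: oddE)
  moreover have "q < (n + 1) div 2" if "even n" "q < n div 2" for q using that by auto
  ultimately show ?thesis unfolding Sigma_system_def using * by simp
qed

section \<open>Reflection of the angle\<close>

text \<open>
  The angle \<open>t = arccos x\<close> is reflected about \<open>\<theta>\<close>; the argument is first clipped to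
  \<open>[cos (\<theta> + \<alpha>), cos \<theta>]\<close>, which makes the map total, continuous and monotone.
\<close>
definition angle_reflection :: "real \<Rightarrow> real \<Rightarrow> real \<Rightarrow> real" where
  "angle_reflection \<theta> \<alpha> x = cos (2 * \<theta> - arccos (max (cos (\<theta> + \<alpha>)) (min (cos \<theta>) x)))"

lemma clipped_angle:
  assumes "0 < \<alpha>" "\<alpha> \<le> \<theta>" "\<theta> + \<alpha> \<le> pi / 2"
  obtains t where "\<theta> \<le> t" "t \<le> \<theta> + \<alpha>" "max (cos (\<theta> + \<alpha>)) (min (cos \<theta>) x) = cos t"
    "angle_reflection \<theta> \<alpha> x = cos (2 * \<theta> - t)"
proof -
  define y where "y = max (cos (\<theta> + \<alpha>)) (min (cos \<theta>) x)"
  have le: "cos (\<theta> + \<alpha>) \<le> cos \<theta>" using assms pi_gt_zero by (intro cos_monotone_0_pi_le; linarith)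
  then have y: "cos (\<theta> + \<alpha>) \<le> y" "y \<le> cos \<theta>" by (auto simp: y_def)
  then have y1: "-1 \<le> y" "y \<le> 1" using cos_ge_minus_one[of "\<theta> + \<alpha>"] cos_le_one[of \<theta>] by linarith+
  have "arccos (cos \<theta>) \<le> arccos y"
    by (rule arccos_le_arccos) (use y y1 in simp_all)
  moreover have "arccos y \<le> arccos (cos (\<theta> + \<alpha>))"
    by (rule arccos_le_arccos) (use y y1 in simp_all)
  moreover have "arccos (cos \<theta>) = \<theta>" "arccos (cos (\<theta> + \<alpha>)) = \<theta> + \<alpha>"
    using assms pi_gt_zero by (intro arccos_cos; linarith)+
  ultimately have "\<theta> \<le> arccos y" "arccos y \<le> \<theta> + \<alpha>" by simp_all
  moreover have "max (cos (\<theta> + \<alpha>)) (min (cos \<theta>) x) = cos (arccos y)"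
    using cos_arccos[OF y1] by (simp only: y_def)
  moreover have "angle_reflection \<theta> \<alpha> x = cos (2 * \<theta> - arccos y)"
    by (simp only: angle_reflection_def y_def)
  ultimately show ?thesis by (rule that)
qed

lemma angle_reflection_cos:
  assumes "0 < \<alpha>" "\<alpha> \<le> \<theta>" "\<theta> + \<alpha> \<le> pi / 2" "\<theta> \<le> t" "t \<le> \<theta> + \<alpha>"
  shows "angle_reflection \<theta> \<alpha> (cos t) = cos (2 * \<theta> - t)"
proof -
  have "cos (\<theta> + \<alpha>) \<le> cos t" "cos t \<le> cos \<theta>"
    using assms pi_gt_zero by (intro cos_monotone_0_pi_le; linarith)+
  moreover have "arccos (cos t) = t" using assms pi_gt_zero by (intro arccos_cos; linarith)
  ultimately show ?thesis by (simp add: angle_reflection_def)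
qed

lemma reflection_angle:
  assumes "0 < \<alpha>" "\<alpha> \<le> \<theta>" "\<theta> + \<alpha> \<le> pi / 2"
  shows "reflection (cos (\<theta> + \<alpha>)) (cos \<theta>) (cos (\<theta> - \<alpha>)) (angle_reflection \<theta> \<alpha>)"
proof
  let ?R = "angle_reflection \<theta> \<alpha>"
  show "0 < cos \<theta>" using assms pi_gt_zero by (intro cos_gt_zero_pi; linarith)
  show "cos (\<theta> + \<alpha>) < cos \<theta>" "cos \<theta> < cos (\<theta> - \<alpha>)"
    using assms pi_gt_zero by (intro cos_monotone_0_pi; linarith)+
  have "cos (\<theta> + \<alpha>) * cos (\<theta> - \<alpha>) = (cos \<theta>)\<^sup>2 * (cos \<alpha>)\<^sup>2 - (sin \<theta>)\<^sup>2 * (sin \<alpha>)\<^sup>2"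
    by (simp add: cos_add cos_diff algebra_simps power2_eq_square)
  also have "\<dots> = (cos \<theta>)\<^sup>2 - (sin \<alpha>)\<^sup>2"
    unfolding sin_squared_eq[of \<theta>] cos_squared_eq[of \<alpha>] by (simp add: algebra_simps)
  finally have "cos (\<theta> + \<alpha>) * cos (\<theta> - \<alpha>) = (cos \<theta>)\<^sup>2 - (sin \<alpha>)\<^sup>2" .
  moreover have "0 < sin \<alpha>" using assms pi_gt_zero by (intro sin_gt_zero; linarith)
  ultimately show "cos (\<theta> + \<alpha>) * cos (\<theta> - \<alpha>) < (cos \<theta>)\<^sup>2" by simp
  show "continuous_on UNIV ?R"
    unfolding angle_reflection_def
  proof (intro continuous_intros continuous_on_arccos')
    have "- 1 \<le> cos (\<theta> + \<alpha>)" "cos \<theta> \<le> 1" "cos (\<theta> + \<alpha>) \<le> 1" by simp_all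
    then have "- 1 \<le> max (cos (\<theta> + \<alpha>)) (min (cos \<theta>) x) \<and> max (cos (\<theta> + \<alpha>)) (min (cos \<theta>) x) \<le> 1" for x
      by linarith
    then show "\<forall>x\<in>UNIV. - 1 \<le> max (cos (\<theta> + \<alpha>)) (min (cos \<theta>) x) \<and> max (cos (\<theta> + \<alpha>)) (min (cos \<theta>) x) \<le> 1"
      by blast
  qed
  show "cos \<theta> \<le> ?R x" for x
  proof -
    obtain t where "\<theta> \<le> t" "t \<le> \<theta> + \<alpha>" "?R x = cos (2 * \<theta> - t)"
      using clipped_angle[OF assms] by metis
    moreover from this have "cos \<theta> \<le> cos (2 * \<theta> - t)"
      using assms pi_gt_zero by (intro cos_monotone_0_pi_le; linarith)
    ultimately show ?thesis by simp
  qed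
  have mono: "?R y \<le> ?R x \<and> (cos (\<theta> + \<alpha>) \<le> x \<longrightarrow> x < y \<longrightarrow> y \<le> cos \<theta> \<longrightarrow> ?R y < ?R x)" if "x \<le> y" for x y
  proof -
    obtain s where s: "\<theta> \<le> s" "s \<le> \<theta> + \<alpha>" "max (cos (\<theta> + \<alpha>)) (min (cos \<theta>) x) = cos s" "?R x = cos (2 * \<theta> - s)"
      using clipped_angle[OF assms] by metis
    obtain t where t: "\<theta> \<le> t" "t \<le> \<theta> + \<alpha>" "max (cos (\<theta> + \<alpha>)) (min (cos \<theta>) y) = cos t" "?R y = cos (2 * \<theta> - t)"
      using clipped_angle[OF assms] by metis
    have "cos s \<le> cos t" unfolding s(3)[symmetric] t(3)[symmetric] using that by auto
    then have "t \<le> s"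
      using s(1,2) t(1,2) assms pi_gt_zero by (subst (asm) cos_mono_le_eq) linarith+
    moreover have "s \<noteq> t" if "cos (\<theta> + \<alpha>) \<le> x" "x < y" "y \<le> cos \<theta>"
      using that s(3) t(3) by auto
    moreover have "cos (2 * \<theta> - t) \<le> cos (2 * \<theta> - s)" if "t \<le> s"
      using that s(1,2) t(1,2) assms pi_gt_zero by (intro cos_monotone_0_pi_le; linarith)
    moreover have "cos (2 * \<theta> - t) < cos (2 * \<theta> - s)" if "t < s"
      using that s(1,2) t(1,2) assms pi_gt_zero by (intro cos_monotone_0_pi; linarith)
    ultimately show ?thesis unfolding s(4) t(4) by (metis order_less_le)
  qed
  show "?R y \<le> ?R x" if "x \<le> y" for x y using mono that by blast
  show "?R y < ?R x" if "cos (\<theta> + \<alpha>) \<le> x" "x < y" "y \<le> cos \<theta>" for x y using mono[of x y] that by simp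
  show "?R (cos (\<theta> + \<alpha>)) = cos (\<theta> - \<alpha>)"
    using angle_reflection_cos[OF assms, of "\<theta> + \<alpha>"] assms by simp
  show "?R (cos \<theta>) = cos \<theta>" using angle_reflection_cos[OF assms, of "\<theta>"] assms by simp
qed

text \<open>
  The reflection about \<open>\<theta> = j\<pi>/\<kappa>\<close> replaces \<open>\<kappa> t\<close> by \<open>2 j \<pi> - \<kappa> t\<close>, so it preserves \<open>cos (\<kappa> t)\<close> and
  changes the sign of \<open>sin (p \<kappa> t)\<close> for all \<open>p\<close> at once.
\<close>
theorem theorem7p2:
  fixes \<kappa> j :: nat
  assumes "\<kappa> \<ge> 4" and "even \<kappa>"
    and "even j" and "2 \<le> j" and "j \<le> \<kappa> div 2"
    and nonempty_interval: "2 * j \<noteq> \<kappa>"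
  shows "\<exists>\<E> :: nat \<Rightarrow> real.
    (\<forall>n\<ge>1. \<E> n \<in> {(cos (real j * pi / real \<kappa>))\<^sup>2 <..<
                     cos ((real j - 1) * pi / real \<kappa>) * cos (real j * pi / real \<kappa>)}
                  \<inter> Theta_set TYPE(2) \<kappa>) \<and>
    (\<forall>n\<ge>1. \<E> (n + 2) < \<E> (n + 1) \<and> \<E> (n + 1) < \<E> n) \<and>
    (\<forall>n\<ge>1. \<E> (2 * n - 1) \<in> Theta_m_set TYPE(2) n \<kappa> \<and> \<E> (2 * n) \<in> Theta_m_set TYPE(2) n \<kappa>) \<and>
    (\<forall>n\<ge>1. \<exists>X :: nat \<Rightarrow> real. Sigma_system \<kappa> n (\<E> n) X \<and>
       \<E> n / cos ((real j - 1) * pi / real \<kappa>) = X 0 \<and>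
       (\<forall>q\<le>n. X q < X (q + 1)) \<and>
       X (n + 1) = cos ((real j - 1) * pi / real \<kappa>))"
proof -
  define \<alpha> where "\<alpha> = pi / real \<kappa>"
  define \<theta> where "\<theta> = real j * \<alpha>"
  define a b c where "a = cos (\<theta> + \<alpha>)" and "b = cos \<theta>" and "c = cos (\<theta> - \<alpha>)"
  define R where "R = angle_reflection \<theta> \<alpha>"
  have \<kappa>: "0 < real \<kappa>" "\<kappa> \<ge> 1" and \<kappa>\<alpha>: "real \<kappa> * \<alpha> = pi" using assms by (auto simp: \<alpha>_def)
  have \<alpha>: "0 < \<alpha>" using \<kappa> by (simp add: \<alpha>_def)
  \<comment> \<open>Both \<open>2 j\<close> and \<open>\<kappa>\<close> are even and \<open>2 j < \<kappa>\<close>, so the reflected arc stays within the first quadrant.\<close>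
  have "2 * (j + 1) \<le> \<kappa>" using assms by presburger
  then have "real (2 * (j + 1)) * \<alpha> \<le> real \<kappa> * \<alpha>" using \<alpha> by (intro mult_right_mono of_nat_mono) auto
  then have le_half: "\<theta> + \<alpha> \<le> pi / 2" unfolding \<kappa>\<alpha> by (simp add: \<theta>_def algebra_simps)
  have \<alpha>\<theta>: "\<alpha> \<le> \<theta>" using mult_right_mono[of 1 "real j" \<alpha>] assms \<alpha> by (simp add: \<theta>_def)
  interpret reflection a b c R
    unfolding a_def b_def c_def R_def by (rule reflection_angle[OF \<alpha> \<alpha>\<theta> le_half])
  have ends: "cos (real j * pi / real \<kappa>) = b" "cos ((real j - 1) * pi / real \<kappa>) = c"
    by (simp_all add: b_def c_def \<theta>_def \<alpha>_def algebra_simps diff_divide_distrib)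
  have angle: "\<exists>t. x = cos t \<and> R x = cos (2 * \<theta> - t) \<and> 0 < sin t \<and> 0 \<le> sin (2 * \<theta> - t)"
    if x: "a < x" "x < b" for x
  proof -
    obtain t where t: "\<theta> \<le> t" "t \<le> \<theta> + \<alpha>" "max (cos (\<theta> + \<alpha>)) (min (cos \<theta>) x) = cos t"
      "angle_reflection \<theta> \<alpha> x = cos (2 * \<theta> - t)"
      using clipped_angle[OF \<alpha> \<alpha>\<theta> le_half] by metis
    then have "x = cos t" using x by (simp add: a_def b_def)
    moreover have "0 < sin t" using t(1,2) \<alpha> \<alpha>\<theta> le_half pi_gt_zero by (intro sin_gt_zero; linarith)
    moreover have "0 \<le> sin (2 * \<theta> - t)" using t(1,2) \<alpha> \<alpha>\<theta> le_half pi_gt_zero by (intro sin_ge_zero; linarith)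
    ultimately show ?thesis using t(4) by (auto simp: R_def)
  qed
  have T: "poly (cheb_T \<kappa>) (R x) = poly (cheb_T \<kappa>) x" if x: "a < x" "x < b" for x
  proof -
    obtain t where t: "x = cos t" "R x = cos (2 * \<theta> - t)" using angle[OF x] by blast
    have "real \<kappa> * (2 * \<theta> - t) = - (real \<kappa> * t) + 2 * real j * (real \<kappa> * \<alpha>)"
      by (simp add: \<theta>_def algebra_simps)
    then have "real \<kappa> * (2 * \<theta> - t) = - (real \<kappa> * t) + real j * (2 * pi)" unfolding \<kappa>\<alpha> by simp
    then show ?thesis
      unfolding t(2) unfolding t(1) poly_cheb_T_cos
      using cos.plus_of_nat[of "- (real \<kappa> * t)" j] by simp
  qed
  have link: "\<exists>l\<ge>0. \<forall>p\<ge>1. cheb_sin (p * \<kappa>) (R x) = - l * cheb_sin (p * \<kappa>) x"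
    if x: "a < x" "x < b" for x
  proof -
    obtain t where t: "x = cos t" "R x = cos (2 * \<theta> - t)" "0 < sin t" "0 \<le> sin (2 * \<theta> - t)"
      using angle[OF x] by blast
    have "cheb_sin (p * \<kappa>) (R x) = - (sin (2 * \<theta> - t) / sin t) * cheb_sin (p * \<kappa>) x" if p: "p \<ge> 1" for p
    proof -
      have pk: "p * \<kappa> \<ge> 1" using p \<kappa> by simp
      have "real (p * \<kappa>) * (2 * \<theta> - t) = - (real (p * \<kappa>) * t) + 2 * real p * real j * (real \<kappa> * \<alpha>)"
        by (simp add: \<theta>_def algebra_simps)
      then have "real (p * \<kappa>) * (2 * \<theta> - t) = - (real (p * \<kappa>) * t) + real (p * j) * (2 * pi)"
        unfolding \<kappa>\<alpha> by simp
      then have "sin (real (p * \<kappa>) * (2 * \<theta> - t)) = - sin (real (p * \<kappa>) * t)"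
        using sin.plus_of_nat[of "- (real (p * \<kappa>) * t)" "p * j"] by simp
      then show ?thesis using t by (simp only: t(1,2) cheb_sin_cos[OF pk]) simp
    qed
    then show ?thesis using t by (intro exI[of _ "sin (2 * \<theta> - t) / sin t"]) simp
  qed
  have zero: "cheb_sin (p * \<kappa>) (cos (real i * \<alpha>)) = 0" if "p \<ge> 1" for p i
  proof -
    have "real (p * \<kappa>) * (real i * \<alpha>) = real (p * i) * (real \<kappa> * \<alpha>)" by simp
    then have "sin (real (p * \<kappa>) * (real i * \<alpha>)) = 0" unfolding \<kappa>\<alpha> by (simp only: sin_npi)
    moreover have "p * \<kappa> \<ge> 1" using that \<kappa> by simp
    ultimately show ?thesis by (simp only: cheb_sin_cos mult_zero_right)
  qed
  have zero_b: "cheb_sin (p * \<kappa>) b = 0" if "p \<ge> 1" for p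
    using zero[OF that, of j] by (simp add: b_def \<theta>_def)
  have zero_c: "cheb_sin (p * \<kappa>) c = 0" if "p \<ge> 1" for p
    using zero[OF that, of "j - 1"] assms by (simp add: c_def \<theta>_def of_nat_diff algebra_simps)
  obtain \<E> where \<E>: "\<And>n. n \<ge> 1 \<Longrightarrow> b\<^sup>2 < \<E> n" "\<And>n. n \<ge> 1 \<Longrightarrow> \<E> n < b * c"
    "\<And>n. n \<ge> 1 \<Longrightarrow> \<E> (n + 1) < \<E> n" "\<And>n. n \<ge> 1 \<Longrightarrow> \<exists>X. reflected_chain R a b c n (\<E> n) X"
    using reflected_chains_exist by blast
  have pos: "0 < \<E> n" if "n \<ge> 1" for n using \<E>(1)[OF that] by (smt (verit) zero_le_power2)
  have Theta_m: "\<E> n \<in> Theta_m_set TYPE(2) ((n + 1) div 2) \<kappa>" if n: "n \<ge> 1" for n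
  proof -
    obtain X where X: "reflected_chain R a b c n (\<E> n) X" using \<E>(4)[OF n] by blast
    show ?thesis
      by (rule Theta_mI[OF n refl _ pos[OF n] X c0 zero_c zero_b link]) (simp add: c_def)
  qed
  have Theta: "\<E> n \<in> Theta_set TYPE(2) \<kappa>" if "n \<ge> 1" for n
    using Theta_m[OF that] Theta_m_subset_Theta[OF \<kappa>(2)] by blast
  have sys: "\<exists>X. Sigma_system \<kappa> n (\<E> n) X \<and> \<E> n / c = X 0 \<and> (\<forall>q\<le>n. X q < X (q + 1)) \<and> X (n + 1) = c"
    if n: "n \<ge> 1" for n
  proof -
    obtain X where X: "reflected_chain R a b c n (\<E> n) X" using \<E>(4)[OF n] by blast
    have "Sigma_system \<kappa> n (\<E> n) X" by (rule Sigma_systemI[OF X n pos[OF n] c0 T])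
    moreover have "\<E> n / c = X 0" "\<forall>q\<le>n. X q < X (q + 1)" "X (n + 1) = c"
      using X unfolding reflected_chain_def by auto
    ultimately show ?thesis by blast
  qed
  show ?thesis
    unfolding ends
  proof (rule exI[of _ \<E>], intro conjI allI impI)
    fix n :: nat assume n: "1 \<le> n"
    show "\<E> n \<in> {b\<^sup>2<..<c * b} \<inter> Theta_set TYPE(2) \<kappa>"
      using \<E>(1,2)[OF n] Theta[OF n] by (simp add: mult.commute)
    show "\<E> (n + 1) < \<E> n" by (rule \<E>(3)[OF n])
    show "\<E> (n + 2) < \<E> (n + 1)" using \<E>(3)[of "n + 1"] by simp
    show "\<E> (2 * n - 1) \<in> Theta_m_set TYPE(2) n \<kappa>" using Theta_m[of "2 * n - 1"] n by simp
    show "\<E> (2 * n) \<in> Theta_m_set TYPE(2) n \<kappa>" using Theta_m[of "2 * n"] n by simp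
    show "\<exists>X. Sigma_system \<kappa> n (\<E> n) X \<and> \<E> n / c = X 0 \<and> (\<forall>q\<le>n. X q < X (q + 1)) \<and> X (n + 1) = c"
      by (rule sys[OF n])
  qed
qed

end
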